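(* Let $K$ be a field of characteristic different from $2$ and $3$. Let $\mathscr P$ be a commutative binary quadratic operad over $K$, $A$ an algebra over $\mathscr P$, and $B$ an algebra over the Koszul dual operad $\mathscr P^!$, and suppose that one of $A$, $B$ is finite-dimensional. Then $$\mathrm{HomLie}\big((A\otimes B)^{(-)}\big)\simeq \mathrm{HomLie}(A)\otimes\mathrm{HomCycl}(B)+\mathrm{Hom2Nilp}(A)\otimes\mathrm{End}(B)+\mathrm{HomCycl}(A)\otimes\mathrm{HomLie}(B)+\mathrm{End}(A)\otimes\mathrm{Hom2Nilp}(B).$$
   Context: All tensor products are over $K$. A binary quadratic operad $\mathscr P$ is called commutative if it is generated by one commutative binary operation, so that $\mathscr P$-algebras are commutative (not necessarily associative) algebras; then algebras over the Koszul dual operad $\mathscr P^!$ are anticommutative algebras. For $A$ an algebra over $\mathscr P$ and $B$ an algebra over $\mathscr P^!$, $(A\otimes B)^{(-)}$ denotes the Lie algebra with underlying vector space $A\otimes B$ and bracket $[a\otimes b,a'\otimes b']=aa'\otimes bb'-a'a\otimes b'b$ for $a,a'\in A$, $b,b'\in B$. For an arbitrary (nonassociative) algebra $C$ over $K$, define the following vector spaces of linear maps $\varphi:C\to C$: - $\mathrm{HomLie}(C)$: those with $(ab)\varphi(c)+(ca)\varphi(b)+(bc)\varphi(a)=0$ for all $a,b,c\in C$ (for a Lie algebra, the product is the bracket); - $\mathrm{HomCycl}(C)$: those with $(ab)\varphi(c)=(ca)\varphi(b)$ for all $a,b,c\in C$; - $\mathrm{Hom2Nilp}(C)$: those with $(ab)\varphi(c)=0$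 for all $a,b,c\in C$. $\mathrm{End}(C)$ is the space of all linear maps $C\to C$. Since one of $A$, $B$ is finite-dimensional, $\mathrm{End}(A\otimes B)$ is naturally identified with $\mathrm{End}(A)\otimes\mathrm{End}(B)$; the right-hand side is a (not necessarily direct) sum of subspaces of $\mathrm{End}(A)\otimes\mathrm{End}(B)$, and the isomorphism $\simeq$ is the one given by this identification. *)

theory Defs
  imports
    Complex_Main
    "HOL-Library.Function_Algebras"
    "HOL-Library.Set_Algebras"
    "HOL-Library.Poly_Mapping"
begin

section \<open>Vector spaces and tensor products\<close>

definition linear_on ::
  "'u::plus set \<Rightarrow> ('k \<Rightarrow> 'u \<Rightarrow> 'u) \<Rightarrow> ('k \<Rightarrow> 'v::plus \<Rightarrow> 'v) \<Rightarrow> ('u \<Rightarrow> 'v) \<Rightarrow> bool" where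
  "linear_on U s1 s2 f \<longleftrightarrow>
    (\<forall>x\<in>U. \<forall>y\<in>U. f (x + y) = f x + f y) \<and> (\<forall>c. \<forall>x\<in>U. f (s1 c x) = s2 c (f x))"

definition finite_dim :: "('k::field \<Rightarrow> 'a::ab_group_add \<Rightarrow> 'a) \<Rightarrow> bool" where
  "finite_dim s \<longleftrightarrow> (\<exists>X. finite X \<and> module.span s X = UNIV)"

definition End :: "('k::field \<Rightarrow> 'a::ab_group_add \<Rightarrow> 'a) \<Rightarrow> ('a \<Rightarrow> 'a) set" where
  "End s = {f. Vector_Spaces.linear s s f}"

definition fun_scale :: "('k \<Rightarrow> 'a \<Rightarrow> 'a) \<Rightarrow> 'k \<Rightarrow> ('x \<Rightarrow> 'a) \<Rightarrow> ('x \<Rightarrow> 'a)" where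
  "fun_scale s c f = (\<lambda>x. s c (f x))"

text \<open>The free vector space on a set \<open>X\<close> consists of the finitely supported functions
  \<open>x :: 'x \<Rightarrow>\<^sub>0 'k\<close> with \<open>keys x \<subseteq> X\<close>.\<close>

definition free_scale :: "'k::field \<Rightarrow> ('x \<Rightarrow>\<^sub>0 'k) \<Rightarrow> ('x \<Rightarrow>\<^sub>0 'k)" where
  "free_scale c = Poly_Mapping.map ((*) c)"

definition free_lift ::
  "('k::field \<Rightarrow> 'v::ab_group_add \<Rightarrow> 'v) \<Rightarrow> ('x \<Rightarrow> 'v) \<Rightarrow> ('x \<Rightarrow>\<^sub>0 'k) \<Rightarrow> 'v" where
  "free_lift s f x = (\<Sum>k\<in>Poly_Mapping.keys x. s (Poly_Mapping.lookup x k) (f k))"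

definition tensor_relations ::
  "('k::field \<Rightarrow> 'a::ab_group_add \<Rightarrow> 'a) \<Rightarrow> 'a set \<Rightarrow> ('k \<Rightarrow> 'b::ab_group_add \<Rightarrow> 'b) \<Rightarrow> 'b set
    \<Rightarrow> ('a \<times> 'b \<Rightarrow>\<^sub>0 'k) set" where
  "tensor_relations sA U sB V =
    {Poly_Mapping.single (a + a', b) 1 - Poly_Mapping.single (a, b) 1 - Poly_Mapping.single (a', b) 1
      | a a' b. a \<in> U \<and> a' \<in> U \<and> b \<in> V} \<union>
    {Poly_Mapping.single (a, b + b') 1 - Poly_Mapping.single (a, b) 1 - Poly_Mapping.single (a, b') 1
      | a b b'. a \<in> U \<and> b \<in> V \<and> b' \<in> V} \<union>
    {Poly_Mapping.single (sA c a, b) 1 - Poly_Mapping.single (a, b) c | c a b. a \<in> U \<and> b \<in> V} \<union>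
    {Poly_Mapping.single (a, sB c b) 1 - Poly_Mapping.single (a, b) c | c a b. a \<in> U \<and> b \<in> V}"

text \<open>The tensor product of \<open>U\<close> and \<open>V\<close> is the free vector space on \<open>U \<times> V\<close> modulo the
  bilinearity relations.  The quotient depends on the scalar multiplications and hence cannot be
  a type constructor; instead \<open>is_tensor_product\<close> says that the type \<open>'t\<close> with the pure tensors
  \<open>tns a b\<close> is this quotient: the linear map from the free vector space to \<open>'t\<close> with
  \<open>(a, b) \<mapsto> tns a b\<close> is onto and its kernel is spanned by the bilinearity relations.\<close>

definition is_tensor_product ::
  "('k::field \<Rightarrow> 'a::ab_group_add \<Rightarrow> 'a) \<Rightarrow> 'a set \<Rightarrow> ('k \<Rightarrow> 'b::ab_group_add \<Rightarrow> 'b) \<Rightarrow> 'b set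
    \<Rightarrow> ('k \<Rightarrow> 't::ab_group_add \<Rightarrow> 't) \<Rightarrow> ('a \<Rightarrow> 'b \<Rightarrow> 't) \<Rightarrow> bool" where
  "is_tensor_product sA U sB V sT tns \<longleftrightarrow>
    vector_space sA \<and> vector_space sB \<and> vector_space sT \<and>
    module.subspace sA U \<and> module.subspace sB V \<and>
    free_lift sT (\<lambda>(a, b). tns a b) ` {x. Poly_Mapping.keys x \<subseteq> U \<times> V} = UNIV \<and>
    {x. Poly_Mapping.keys x \<subseteq> U \<times> V \<and> free_lift sT (\<lambda>(a, b). tns a b) x = 0} =
      module.span free_scale (tensor_relations sA U sB V)"

definition subspace_tensor ::
  "('k::field \<Rightarrow> 't::ab_group_add \<Rightarrow> 't) \<Rightarrow> ('a \<Rightarrow> 'b \<Rightarrow> 't) \<Rightarrow> 'a set \<Rightarrow> 'b set \<Rightarrow> 't set" where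
  "subspace_tensor sT tns U V = module.span sT {tns a b | a b. a \<in> U \<and> b \<in> V}"

section \<open>Nonassociative algebras\<close>

definition HomLie ::
  "('k::field \<Rightarrow> 'c::ab_group_add \<Rightarrow> 'c) \<Rightarrow> ('c \<Rightarrow> 'c \<Rightarrow> 'c) \<Rightarrow> ('c \<Rightarrow> 'c) set" where
  "HomLie s m = {\<phi> \<in> End s. \<forall>a b c. m (m a b) (\<phi> c) + m (m c a) (\<phi> b) + m (m b c) (\<phi> a) = 0}"

definition HomCycl ::
  "('k::field \<Rightarrow> 'c::ab_group_add \<Rightarrow> 'c) \<Rightarrow> ('c \<Rightarrow> 'c \<Rightarrow> 'c) \<Rightarrow> ('c \<Rightarrow> 'c) set" where
  "HomCycl s m = {\<phi> \<in> End s. \<forall>a b c. m (m a b) (\<phi> c) = m (m c a) (\<phi> b)}"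

definition Hom2Nilp ::
  "('k::field \<Rightarrow> 'c::ab_group_add \<Rightarrow> 'c) \<Rightarrow> ('c \<Rightarrow> 'c \<Rightarrow> 'c) \<Rightarrow> ('c \<Rightarrow> 'c) set" where
  "Hom2Nilp s m = {\<phi> \<in> End s. \<forall>a b c. m (m a b) (\<phi> c) = 0}"

text \<open>The bracket of \<open>(A \<otimes> B)\<^sup>(\<^sup>-\<^sup>)\<close> is the unique bilinear map with the given values on pure
  tensors; it exists whenever \<open>mA\<close> and \<open>mB\<close> are bilinear (see \<open>tensor_bracket_ex1\<close> below).\<close>

definition is_tensor_bracket ::
  "('k::field \<Rightarrow> 't::ab_group_add \<Rightarrow> 't) \<Rightarrow> ('a \<Rightarrow> 'b \<Rightarrow> 't) \<Rightarrow> ('a \<Rightarrow> 'a \<Rightarrow> 'a) \<Rightarrow> ('b \<Rightarrow> 'b \<Rightarrow> 'b)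
    \<Rightarrow> ('t \<Rightarrow> 't \<Rightarrow> 't) \<Rightarrow> bool" where
  "is_tensor_bracket sT tns mA mB br \<longleftrightarrow>
    (\<forall>x. Vector_Spaces.linear sT sT (br x)) \<and> (\<forall>y. Vector_Spaces.linear sT sT (\<lambda>x. br x y)) \<and>
    (\<forall>a b a' b'. br (tns a b) (tns a' b') = tns (mA a a') (mB b b') - tns (mA a' a) (mB b' b))"

definition tensor_bracket ::
  "('k::field \<Rightarrow> 't::ab_group_add \<Rightarrow> 't) \<Rightarrow> ('a \<Rightarrow> 'b \<Rightarrow> 't) \<Rightarrow> ('a \<Rightarrow> 'a \<Rightarrow> 'a) \<Rightarrow> ('b \<Rightarrow> 'b \<Rightarrow> 'b)
    \<Rightarrow> 't \<Rightarrow> 't \<Rightarrow> 't" where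
  "tensor_bracket sT tns mA mB = (THE br. is_tensor_bracket sT tns mA mB br)"

text \<open>The natural identification of \<open>End(A) \<otimes> End(B)\<close> (scalar multiplication \<open>sE\<close>, pure tensors
  \<open>tnsE\<close>) with \<open>End(A \<otimes> B)\<close> sends \<open>\<phi> \<otimes> \<psi>\<close> to the map \<open>a \<otimes> b \<mapsto> \<phi>(a) \<otimes> \<psi>(b)\<close>.\<close>

definition is_End_identification ::
  "('k::field \<Rightarrow> 'a::ab_group_add \<Rightarrow> 'a) \<Rightarrow> ('k \<Rightarrow> 'b::ab_group_add \<Rightarrow> 'b)
    \<Rightarrow> ('k \<Rightarrow> 't::ab_group_add \<Rightarrow> 't) \<Rightarrow> ('a \<Rightarrow> 'b \<Rightarrow> 't)
    \<Rightarrow> ('k \<Rightarrow> 'e::ab_group_add \<Rightarrow> 'e) \<Rightarrow> (('a \<Rightarrow> 'a) \<Rightarrow> ('b \<Rightarrow> 'b) \<Rightarrow> 'e)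
    \<Rightarrow> ('e \<Rightarrow> 't \<Rightarrow> 't) \<Rightarrow> bool" where
  "is_End_identification sA sB sT tns sE tnsE \<Theta> \<longleftrightarrow>
    Vector_Spaces.linear sE (fun_scale sT) \<Theta> \<and> bij_betw \<Theta> UNIV (End sT) \<and>
    (\<forall>\<phi>\<in>End sA. \<forall>\<psi>\<in>End sB. \<forall>a b. \<Theta> (tnsE \<phi> \<psi>) (tns a b) = tns (\<phi> a) (\<psi> b))"

section \<open>Symmetric operads\<close>

text \<open>Operads are given by partial compositions and are indexed by finite sets of inputs rather
  than by arities: \<open>piece S\<close> is the space of operations with inputs labelled by \<open>S\<close>, an injection
  \<open>f\<close> on \<open>S\<close> relabels the inputs (bijections \<open>S \<rightarrow> S\<close> give the symmetric group action), and
  \<open>pcomp S i T p q\<close> is \<open>p \<circ>\<^sub>i q\<close>, the operation \<open>q\<close> plugged into the input \<open>i\<close> of \<open>p\<close>, with inputs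
  \<open>(S - {i}) \<union> T\<close>.\<close>

record ('k, 'p) operad_data =
  scale :: "'k \<Rightarrow> 'p \<Rightarrow> 'p"
  piece :: "nat set \<Rightarrow> 'p set"
  relabel :: "nat set \<Rightarrow> (nat \<Rightarrow> nat) \<Rightarrow> 'p \<Rightarrow> 'p"
  pcomp :: "nat set \<Rightarrow> nat \<Rightarrow> nat set \<Rightarrow> 'p \<Rightarrow> 'p \<Rightarrow> 'p"
  unit :: "nat \<Rightarrow> 'p"

definition composable :: "nat set \<Rightarrow> nat \<Rightarrow> nat set \<Rightarrow> bool" where
  "composable S i T \<longleftrightarrow> finite S \<and> finite T \<and> i \<in> S \<and> (S - {i}) \<inter> T = {}"

locale operad =
  fixes P :: "('k::field, 'p::ab_group_add) operad_data"
  assumes vector_space_scale: "vector_space (scale P)"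
    and subspace_piece: "finite S \<Longrightarrow> module.subspace (scale P) (piece P S)"
    and relabel_piece: "finite S \<Longrightarrow> inj_on f S \<Longrightarrow> p \<in> piece P S \<Longrightarrow> relabel P S f p \<in> piece P (f ` S)"
    and relabel_linear: "finite S \<Longrightarrow> inj_on f S \<Longrightarrow> linear_on (piece P S) (scale P) (scale P) (relabel P S f)"
    and relabel_cong: "finite S \<Longrightarrow> inj_on f S \<Longrightarrow> p \<in> piece P S \<Longrightarrow> (\<And>i. i \<in> S \<Longrightarrow> f i = g i) \<Longrightarrow>
      relabel P S f p = relabel P S g p"
    and relabel_id: "finite S \<Longrightarrow> p \<in> piece P S \<Longrightarrow> relabel P S id p = p"
    and relabel_relabel: "finite S \<Longrightarrow> inj_on f S \<Longrightarrow> inj_on g (f ` S) \<Longrightarrow> p \<in> piece P S \<Longrightarrow>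
      relabel P (f ` S) g (relabel P S f p) = relabel P S (g \<circ> f) p"
    and unit_piece: "unit P i \<in> piece P {i}"
    and relabel_unit: "relabel P {i} f (unit P i) = unit P (f i)"
    and comp_piece: "composable S i T \<Longrightarrow> p \<in> piece P S \<Longrightarrow> q \<in> piece P T \<Longrightarrow>
      pcomp P S i T p q \<in> piece P ((S - {i}) \<union> T)"
    and comp_linear_left: "composable S i T \<Longrightarrow> q \<in> piece P T \<Longrightarrow>
      linear_on (piece P S) (scale P) (scale P) (\<lambda>p. pcomp P S i T p q)"
    and comp_linear_right: "composable S i T \<Longrightarrow> p \<in> piece P S \<Longrightarrow>
      linear_on (piece P T) (scale P) (scale P) (\<lambda>q. pcomp P S i T p q)"
    and comp_unit_left: "finite T \<Longrightarrow> q \<in> piece P T \<Longrightarrow> pcomp P {i} i T (unit P i) q = q"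
    and comp_unit_right: "finite S \<Longrightarrow> i \<in> S \<Longrightarrow> p \<in> piece P S \<Longrightarrow> pcomp P S i {i} p (unit P i) = p"
    and comp_sequential: "composable S i T \<Longrightarrow> composable T j U \<Longrightarrow> (S - {i}) \<inter> U = {} \<Longrightarrow>
      p \<in> piece P S \<Longrightarrow> q \<in> piece P T \<Longrightarrow> r \<in> piece P U \<Longrightarrow>
      pcomp P ((S - {i}) \<union> T) j U (pcomp P S i T p q) r =
      pcomp P S i ((T - {j}) \<union> U) p (pcomp P T j U q r)"
    and comp_parallel: "composable S i T \<Longrightarrow> composable S j U \<Longrightarrow> i \<noteq> j \<Longrightarrow> T \<inter> U = {} \<Longrightarrow>
      p \<in> piece P S \<Longrightarrow> q \<in> piece P T \<Longrightarrow> r \<in> piece P U \<Longrightarrow>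
      pcomp P ((S - {i}) \<union> T) j U (pcomp P S i T p q) r =
      pcomp P ((S - {j}) \<union> U) i T (pcomp P S j U p r) q"
    and comp_relabel: "composable S i T \<Longrightarrow> inj_on f S \<Longrightarrow> inj_on g T \<Longrightarrow>
      f ` (S - {i}) \<inter> g ` T = {} \<Longrightarrow> p \<in> piece P S \<Longrightarrow> q \<in> piece P T \<Longrightarrow>
      pcomp P (f ` S) (f i) (g ` T) (relabel P S f p) (relabel P T g q) =
      relabel P ((S - {i}) \<union> T) (\<lambda>x. if x \<in> T then g x else f x) (pcomp P S i T p q)"

locale operad_morphism = P: operad P + Q: operad Q
  for P :: "('k::field, 'p::ab_group_add) operad_data"
    and Q :: "('k, 'q::ab_group_add) operad_data" +
  fixes h :: "nat set \<Rightarrow> 'p \<Rightarrow> 'q"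
  assumes morphism_piece: "finite S \<Longrightarrow> p \<in> piece P S \<Longrightarrow> h S p \<in> piece Q S"
    and morphism_linear: "finite S \<Longrightarrow> linear_on (piece P S) (scale P) (scale Q) (h S)"
    and morphism_relabel: "finite S \<Longrightarrow> inj_on f S \<Longrightarrow> p \<in> piece P S \<Longrightarrow>
      h (f ` S) (relabel P S f p) = relabel Q S f (h S p)"
    and morphism_unit: "h {i} (unit P i) = unit Q i"
    and morphism_comp: "composable S i T \<Longrightarrow> p \<in> piece P S \<Longrightarrow> q \<in> piece P T \<Longrightarrow>
      h ((S - {i}) \<union> T) (pcomp P S i T p q) = pcomp Q S i T (h S p) (h T q)"

text \<open>The operadic ideal generated by the elements \<open>G S\<close> of \<open>piece P S\<close>.\<close>

inductive operad_ideal ::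
  "('k::field, 'p::ab_group_add) operad_data \<Rightarrow> (nat set \<Rightarrow> 'p set) \<Rightarrow> nat set \<Rightarrow> 'p \<Rightarrow> bool"
  for P G where
  ideal_gen: "finite S \<Longrightarrow> p \<in> G S \<Longrightarrow> p \<in> piece P S \<Longrightarrow> operad_ideal P G S p"
| ideal_zero: "finite S \<Longrightarrow> operad_ideal P G S 0"
| ideal_add: "operad_ideal P G S p \<Longrightarrow> operad_ideal P G S q \<Longrightarrow> operad_ideal P G S (p + q)"
| ideal_scale: "operad_ideal P G S p \<Longrightarrow> operad_ideal P G S (scale P c p)"
| ideal_relabel: "operad_ideal P G S p \<Longrightarrow> inj_on f S \<Longrightarrow> operad_ideal P G (f ` S) (relabel P S f p)"
| ideal_comp_left: "operad_ideal P G S p \<Longrightarrow> composable S i T \<Longrightarrow> q \<in> piece P T \<Longrightarrow>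
    operad_ideal P G ((S - {i}) \<union> T) (pcomp P S i T p q)"
| ideal_comp_right: "p \<in> piece P S \<Longrightarrow> composable S i T \<Longrightarrow> operad_ideal P G T q \<Longrightarrow>
    operad_ideal P G ((S - {i}) \<union> T) (pcomp P S i T p q)"

text \<open>The endomorphism operad of a vector space: an operation with inputs \<open>S\<close> is a multilinear
  map \<open>f :: (nat \<Rightarrow> 'a) \<Rightarrow> 'a\<close> in the arguments with index in \<open>S\<close> that ignores all others.\<close>

definition End_operad ::
  "('k::field \<Rightarrow> 'a::ab_group_add \<Rightarrow> 'a) \<Rightarrow> ('k, (nat \<Rightarrow> 'a) \<Rightarrow> 'a) operad_data" where
  "End_operad s = \<lparr>
    scale = fun_scale s,
    piece = (\<lambda>S. {f. (\<forall>x y. (\<forall>i\<in>S. x i = y i) \<longrightarrow> f x = f y) \<and>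
                     (\<forall>i\<in>S. \<forall>x. Vector_Spaces.linear s s (\<lambda>a. f (x(i := a))))}),
    relabel = (\<lambda>S g f x. f (\<lambda>i. x (g i))),
    pcomp = (\<lambda>S i T f g x. f (x(i := g x))),
    unit = (\<lambda>i x. x i)\<rparr>"

definition operad_algebra ::
  "('k::field, 'p::ab_group_add) operad_data \<Rightarrow> ('k \<Rightarrow> 'a::ab_group_add \<Rightarrow> 'a)
    \<Rightarrow> (nat set \<Rightarrow> 'p \<Rightarrow> (nat \<Rightarrow> 'a) \<Rightarrow> 'a) \<Rightarrow> bool" where
  "operad_algebra P s \<alpha> \<longleftrightarrow> vector_space s \<and> operad_morphism P (End_operad s) \<alpha>"

text \<open>The product on an algebra given by a binary operation \<open>\<mu> \<in> piece P {0, 1}\<close>.\<close>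

definition algebra_product ::
  "(nat set \<Rightarrow> 'p \<Rightarrow> (nat \<Rightarrow> 'a) \<Rightarrow> 'a) \<Rightarrow> 'p \<Rightarrow> 'a \<Rightarrow> 'a \<Rightarrow> 'a" where
  "algebra_product \<alpha> \<mu> a b = \<alpha> {0, 1} \<mu> (\<lambda>i. if i = 0 then a else b)"

section \<open>Quadratic operads generated by one binary operation\<close>

text \<open>The free operad on a binary operation without symmetry: multilinear nonassociative
  polynomials.\<close>

datatype monomial = Var nat | Mult monomial monomial

primrec var_list :: "monomial \<Rightarrow> nat list" where
  "var_list (Var i) = [i]"
| "var_list (Mult t u) = var_list t @ var_list u"

primrec subst :: "(nat \<Rightarrow> monomial) \<Rightarrow> monomial \<Rightarrow> monomial" where
  "subst \<sigma> (Var i) = \<sigma> i"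
| "subst \<sigma> (Mult t u) = Mult (subst \<sigma> t) (subst \<sigma> u)"

definition monom :: "monomial \<Rightarrow> monomial \<Rightarrow>\<^sub>0 'k::field" where
  "monom t = Poly_Mapping.single t 1"

definition magmatic_operad :: "('k::field, monomial \<Rightarrow>\<^sub>0 'k) operad_data" where
  "magmatic_operad = \<lparr>
    scale = free_scale,
    piece = (\<lambda>S. {p. \<forall>t\<in>Poly_Mapping.keys p. distinct (var_list t) \<and> set (var_list t) = S}),
    relabel = (\<lambda>S g p. free_lift free_scale (\<lambda>t. monom (subst (\<lambda>i. Var (g i)) t)) p),
    pcomp = (\<lambda>S i T p q. free_lift free_scale (\<lambda>t.
              free_lift free_scale (\<lambda>u. monom (subst (Var(i := u)) t)) q) p),
    unit = (\<lambda>i. monom (Var i))\<rparr>"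

text \<open>Let \<open>E\<close> be the one-dimensional representation of \<open>S\<^sub>2\<close> on which the transposition acts by
  \<open>\<epsilon> = \<plusminus>1\<close>, with basis \<open>xy\<close>.  The arity 3 component of the free operad on \<open>E\<close> has the basis
  \<open>(xy)z, (yz)x, (zx)y\<close>; a subspace \<open>R\<close> of it is given by the coordinates in this basis.  Up to
  the sign \<open>\<epsilon>\<close>, which is irrelevant for subspaces, \<open>S\<^sub>3\<close> permutes the basis.\<close>

definition relation_space :: "('k::field \<times> 'k \<times> 'k) set \<Rightarrow> bool" where
  "relation_space R \<longleftrightarrow>
    (0, 0, 0) \<in> R \<and>
    (\<forall>u v w u' v' w'. (u, v, w) \<in> R \<and> (u', v', w') \<in> R \<longrightarrow> (u + u', v + v', w + w') \<in> R) \<and>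
    (\<forall>c u v w. (u, v, w) \<in> R \<longrightarrow> (c * u, c * v, c * w) \<in> R) \<and>
    (\<forall>u v w. (u, v, w) \<in> R \<longrightarrow> (v, w, u) \<in> R \<and> (v, u, w) \<in> R)"

text \<open>The free operad on \<open>E\<close> is the magmatic operad modulo the ideal generated by \<open>xy - \<epsilon> yx\<close>, so
  the quadratic operad \<open>P(E, R)\<close> is its quotient by the following ideal generators.\<close>

definition quadratic_relations ::
  "'k::field \<Rightarrow> ('k \<times> 'k \<times> 'k) set \<Rightarrow> nat set \<Rightarrow> (monomial \<Rightarrow>\<^sub>0 'k) set" where
  "quadratic_relations \<epsilon> R S =
    (let x = Var 0; y = Var 1; z = Var 2 in
      if S = {0, 1} then {monom (Mult x y) - free_scale \<epsilon> (monom (Mult y x))}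
      else if S = {0, 1, 2} then
        {free_scale u (monom (Mult (Mult x y) z)) + free_scale v (monom (Mult (Mult y z) x))
          + free_scale w (monom (Mult (Mult z x) y)) | u v w. (u, v, w) \<in> R}
      else {})"

definition quadratic_operad ::
  "('k::field, 'p::ab_group_add) operad_data \<Rightarrow> 'p \<Rightarrow> 'k \<Rightarrow> ('k \<times> 'k \<times> 'k) set \<Rightarrow> bool" where
  "quadratic_operad P \<mu> \<epsilon> R \<longleftrightarrow>
    \<epsilon> \<in> {1, -1} \<and> relation_space R \<and>
    (\<exists>\<pi>. operad_morphism magmatic_operad P \<pi> \<and>
      \<pi> {0, 1} (monom (Mult (Var 0) (Var 1))) = \<mu> \<and>
      (\<forall>S. finite S \<longrightarrow> \<pi> S ` piece magmatic_operad S = piece P S) \<and>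
      (\<forall>S. finite S \<longrightarrow> {p \<in> piece magmatic_operad S. \<pi> S p = 0} =
        {p. operad_ideal magmatic_operad (quadratic_relations \<epsilon> R) S p}))"

definition commutative_quadratic_operad ::
  "('k::field, 'p::ab_group_add) operad_data \<Rightarrow> 'p \<Rightarrow> bool" where
  "commutative_quadratic_operad P \<mu> \<longleftrightarrow> (\<exists>R. quadratic_operad P \<mu> 1 R)"

text \<open>The Koszul dual of \<open>P(E, R)\<close> is \<open>P(E\<^sup>* \<otimes> sgn, R\<^sup>\<bottom>)\<close>, where \<open>R\<^sup>\<bottom>\<close> is the orthogonal
  complement for the pairing under which the bases \<open>(xy)z, (yz)x, (zx)y\<close> of both arity 3
  components are dual to each other.\<close>

definition orthogonal_relations :: "('k::field \<times> 'k \<times> 'k) set \<Rightarrow> ('k \<times> 'k \<times> 'k) set" where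
  "orthogonal_relations R = {(u', v', w'). \<forall>(u, v, w)\<in>R. u * u' + v * v' + w * w' = 0}"

definition koszul_dual_operad ::
  "('k::field, 'p::ab_group_add) operad_data \<Rightarrow> 'p \<Rightarrow> ('k, 'q::ab_group_add) operad_data \<Rightarrow> 'q
    \<Rightarrow> bool" where
  "koszul_dual_operad P \<mu> Q \<nu> \<longleftrightarrow>
    (\<exists>\<epsilon> R. quadratic_operad P \<mu> \<epsilon> R \<and> quadratic_operad Q \<nu> (-\<epsilon>) (orthogonal_relations R))"

section \<open>Well-definedness\<close>

text \<open>The bracket on a tensor product exists and is unique, and the magmatic operad and the
  endomorphism operad are operads.\<close>

lemma vector_space_simps: "vector_space s \<Longrightarrow> s c (x + y) = s c x + s c y \<and> s (c + d) x = s c x + s d x \<and> s c (s d x) = s (c * d) x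
  \<and> s 1 x = x \<and> s 0 x = 0 \<and> s c 0 = 0"
proof -
  assume "vector_space s"
  then interpret vector_space s .
  show ?thesis by (simp add: scale_right_distrib scale_left_distrib)
qed

lemma lookup_free_scale [simp]: "Poly_Mapping.lookup (free_scale c x) k = c * Poly_Mapping.lookup x k"
  by (simp add: free_scale_def Poly_Mapping.map.rep_eq when_def)

lemma vector_space_free_scale: "vector_space (free_scale :: 'k::field \<Rightarrow> ('x \<Rightarrow>\<^sub>0 'k) \<Rightarrow> _)"
  by unfold_locales (auto intro!: poly_mapping_eqI simp: lookup_add algebra_simps)

lemma free_scale_single [simp]: "free_scale c (Poly_Mapping.single t d) = Poly_Mapping.single t (c * d)"
  by (auto intro!: poly_mapping_eqI simp: lookup_single when_def)

lemma free_lift_superset: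
  assumes "vector_space s" "finite X" "Poly_Mapping.keys x \<subseteq> X"
  shows "free_lift s f x = (\<Sum>k\<in>X. s (Poly_Mapping.lookup x k) (f k))"
  unfolding free_lift_def
  by (rule sum.mono_neutral_left) (use assms vector_space_simps[OF assms(1)] in \<open>auto simp: in_keys_iff\<close>)

lemma free_lift_add:
  assumes "vector_space s" shows "free_lift s f (x + y) = free_lift s f x + free_lift s f y"
proof -
  let ?X = "Poly_Mapping.keys x \<union> Poly_Mapping.keys y"
  have "Poly_Mapping.keys (x + y) \<subseteq> ?X" by (rule keys_add)
  then show ?thesis
    by (simp add: free_lift_superset[OF assms, of ?X] lookup_add vector_space_simps[OF assms] sum.distrib)
qed

lemma free_lift_scale:
  assumes "vector_space s" shows "free_lift s f (free_scale c x) = s c (free_lift s f x)"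
proof -
  interpret vector_space s by fact
  let ?X = "Poly_Mapping.keys x"
  have "Poly_Mapping.keys (free_scale c x) \<subseteq> ?X" by (auto simp: in_keys_iff)
  then show ?thesis
    by (simp add: free_lift_superset[OF assms, of ?X] scale_sum_right)
qed

lemma free_lift_zero [simp]: "free_lift s f 0 = 0"
  by (simp add: free_lift_def)

lemma free_lift_single:
  assumes "vector_space s" shows "free_lift s f (Poly_Mapping.single t c) = s c (f t)"
  by (subst free_lift_superset[OF assms, of "{t}"]) (auto simp: lookup_single)

lemma free_lift_cong:
  "(\<And>k. k \<in> Poly_Mapping.keys x \<Longrightarrow> f k = g k) \<Longrightarrow> free_lift s f x = free_lift s g x"
  by (simp add: free_lift_def)

lemma linear_iff_vs: "vector_space s1 \<Longrightarrow> vector_space s2 \<Longrightarrow>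
  Vector_Spaces.linear s1 s2 f \<longleftrightarrow> (\<forall>x y. f (x + y) = f x + f y) \<and> (\<forall>c x. f (s1 c x) = s2 c (f x))"
  by (simp add: linear_iff_module_hom module_hom_def module_hom_axioms_def module_iff_vector_space)

lemma free_lift_linear:
  assumes "vector_space s" shows "Vector_Spaces.linear free_scale s (free_lift s f)"
  by (simp add: linear_iff_vs[OF vector_space_free_scale assms] free_lift_add[OF assms] free_lift_scale[OF assms])

lemma free_lift_sum:
  assumes "vector_space s" shows "free_lift s f (sum g X) = (\<Sum>i\<in>X. free_lift s f (g i))"
  by (induction X rule: infinite_finite_induct) (auto simp: free_lift_add[OF assms])

lemma free_lift_lift:
  assumes "vector_space s"
  shows "free_lift s f (free_lift free_scale g x) = free_lift s (\<lambda>k. free_lift s f (g k)) x"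
  by (simp add: free_lift_def[of free_scale] free_lift_sum[OF assms] free_lift_scale[OF assms])
     (simp add: free_lift_def)

lemma free_lift_swap:
  assumes "vector_space s"
  shows "free_lift s (\<lambda>u. free_lift s (\<lambda>v. h u v) y) x = free_lift s (\<lambda>v. free_lift s (\<lambda>u. h u v) x) y"
proof -
  interpret vector_space s by fact
  show ?thesis
    unfolding free_lift_def scale_sum_right
    by (subst sum.swap) (simp add: mult.commute)
qed

lemma free_lift_monom [simp]:
  "free_lift free_scale (f :: _ \<Rightarrow> 'x \<Rightarrow>\<^sub>0 'k::field) (monom t) = f t"
  by (simp add: monom_def free_lift_single[OF vector_space_free_scale] vector_space_simps[OF vector_space_free_scale])

lemma free_lift_id [simp]: "free_lift free_scale monom (p :: _ \<Rightarrow>\<^sub>0 'k::field) = p"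
  unfolding free_lift_def monom_def
  by (auto intro!: poly_mapping_eqI simp: lookup_sum lookup_single when_def in_keys_iff)

lemma keys_monom [simp]: "Poly_Mapping.keys (monom t :: _ \<Rightarrow>\<^sub>0 'k::field) = {t}"
  by (simp add: monom_def)

lemma keys_free_lift:
  fixes f :: "_ \<Rightarrow> _ \<Rightarrow>\<^sub>0 'k::field"
  shows "Poly_Mapping.keys (free_lift free_scale f p) \<subseteq> (\<Union>t\<in>Poly_Mapping.keys p. Poly_Mapping.keys (f t))"
  unfolding free_lift_def
  by (rule order.trans[OF keys_sum]) (force simp: in_keys_iff)

lemma tensor_lift_ex:
  assumes T: "is_tensor_product sA UNIV sB UNIV sT tns" and C: "vector_space sC"
    and l: "\<And>b. Vector_Spaces.linear sA sC (\<lambda>a. f a b)" and r: "\<And>a. Vector_Spaces.linear sB sC (f a)"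
  shows "\<exists>g. Vector_Spaces.linear sT sC g \<and> (\<forall>a b. g (tns a b) = f a b)"
proof -
  have vs: "vector_space sA" "vector_space sB" "vector_space sT"
    and onto: "range (free_lift sT (\<lambda>(a, b). tns a b)) = UNIV"
    and ker: "{x. free_lift sT (\<lambda>(a, b). tns a b) x = 0} = module.span free_scale (tensor_relations sA UNIV sB UNIV)"
    using T by (auto simp: is_tensor_product_def)
  let ?L = "free_lift sT (\<lambda>(a, b). tns a b)" and ?F = "free_lift sC (\<lambda>(a, b). f a b)"
  note add = free_lift_add[OF vs(3)] free_lift_add[OF C] and sc = free_lift_scale[OF vs(3)] free_lift_scale[OF C]
    and single = free_lift_single[OF vs(3)] free_lift_single[OF C]
  interpret L: Vector_Spaces.linear free_scale sT ?L by (rule free_lift_linear[OF vs(3)])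
  interpret F: Vector_Spaces.linear free_scale sC ?F by (rule free_lift_linear[OF C])
  interpret C: vector_space sC by fact
  note l' = l[unfolded linear_iff_vs[OF vs(1) C]] and r' = r[unfolded linear_iff_vs[OF vs(2) C]]
  have rel: "?F x = 0" if "x \<in> tensor_relations sA UNIV sB UNIV" for x
    using that unfolding tensor_relations_def
    by (auto simp: F.diff single l' r')
  have F0: "?F x = 0" if "?L x = 0" for x
  proof -
    have "x \<in> module.span free_scale (tensor_relations sA UNIV sB UNIV)" using that ker by auto
    with rel show ?thesis by (rule F.eq_0_on_span)
  qed
  define g where "g t = ?F (inv ?L t)" for t
  have LI: "?L (inv ?L t) = t" for t using onto by (simp add: surj_f_inv_f)
  have g: "g (?L x) = ?F x" for x
  proof -
    have "?L (inv ?L (?L x) - x) = 0" by (simp add: L.diff LI)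
    then have "?F (inv ?L (?L x) - x) = 0" by (rule F0)
    then show ?thesis by (simp add: g_def F.diff)
  qed
  have "g (x + y) = g x + g y" for x y
    using g[of "inv ?L x + inv ?L y"] by (simp add: add LI g_def)
  moreover have "g (sT c x) = sC c (g x)" for c x
    using g[of "free_scale c (inv ?L x)"] by (simp add: sc LI g_def)
  moreover have "g (tns a b) = f a b" for a b
    using g[of "Poly_Mapping.single (a,b) 1"] by (simp add: single vector_space_simps[OF vs(3)] vector_space_simps[OF C])
  ultimately show ?thesis using linear_iff_vs[OF vs(3) C] by blast
qed

lemma tensor_ext:
  assumes T: "is_tensor_product sA UNIV sB UNIV sT tns"
    and g: "Vector_Spaces.linear sT sC g" and h: "Vector_Spaces.linear sT sC h"
    and eq: "\<And>a b. g (tns a b) = h (tns a b)"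
  shows "g = h"
proof
  fix t
  have "vector_space sT" and "range (free_lift sT (\<lambda>(a, b). tns a b)) = UNIV"
    using T by (auto simp: is_tensor_product_def)
  then obtain x where x: "t = free_lift sT (\<lambda>(a, b). tns a b) x" by (metis UNIV_I imageE)
  interpret g: Vector_Spaces.linear sT sC g by fact
  interpret h: Vector_Spaces.linear sT sC h by fact
  show "g t = h t"
    unfolding x free_lift_def by (auto simp: g.sum h.sum g.scale h.scale eq split: prod.splits intro!: sum.cong)
qed

lemma vector_space_fun_scale:
  fixes s :: "'k::field \<Rightarrow> 'a::ab_group_add \<Rightarrow> 'a"
  assumes "vector_space s"
  shows "vector_space (fun_scale s :: 'k \<Rightarrow> ('x \<Rightarrow> 'a) \<Rightarrow> ('x \<Rightarrow> 'a))"
  using assms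
  unfolding vector_space_def fun_scale_def by (auto simp: fun_eq_iff)

lemma tns_bilinear:
  assumes T: "is_tensor_product sA UNIV sB UNIV sT tns"
  shows "Vector_Spaces.linear sA sT (\<lambda>a. tns a b)" "Vector_Spaces.linear sB sT (tns a)"
proof -
  have vs: "vector_space sA" "vector_space sB" "vector_space sT"
    and ker: "{x. free_lift sT (\<lambda>(a, b). tns a b) x = 0} = module.span free_scale (tensor_relations sA UNIV sB UNIV)"
    using T by (auto simp: is_tensor_product_def)
  let ?L = "free_lift sT (\<lambda>(a, b). tns a b)"
  interpret L: Vector_Spaces.linear free_scale sT ?L by (rule free_lift_linear[OF vs(3)])
  interpret T: vector_space sT by fact
  have 0: "?L x = 0" if "x \<in> tensor_relations sA UNIV sB UNIV" for x
    using ker that L.vs1.span_base by blast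
  note single = free_lift_single[OF vs(3)]
  have M: "Poly_Mapping.single (a + a', b) 1 - Poly_Mapping.single (a, b) 1 - Poly_Mapping.single (a', b) 1
      \<in> tensor_relations sA UNIV sB UNIV"
    "Poly_Mapping.single (a, b + b') 1 - Poly_Mapping.single (a, b) 1 - Poly_Mapping.single (a, b') 1
      \<in> tensor_relations sA UNIV sB UNIV"
    "Poly_Mapping.single (sA c a, b) 1 - Poly_Mapping.single (a, b) c \<in> tensor_relations sA UNIV sB UNIV"
    "Poly_Mapping.single (a, sB c b) 1 - Poly_Mapping.single (a, b) c \<in> tensor_relations sA UNIV sB UNIV"
    for a a' b b' c
    unfolding tensor_relations_def by blast+
  have "tns (a + a') b = tns a b + tns a' b" for a a' b
    using 0[OF M(1)[of a a' b]] by (simp add: L.diff single diff_eq_eq add.commute)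
  moreover have "tns a (b + b') = tns a b + tns a b'" for a b b'
    using 0[OF M(2)[of a b b']] by (simp add: L.diff single diff_eq_eq add.commute)
  moreover have "tns (sA c a) b = sT c (tns a b)" for a b c
    using 0[OF M(3)[of c a b]] by (simp add: L.diff single)
  moreover have "tns a (sB c b) = sT c (tns a b)" for a b c
    using 0[OF M(4)[of a c b]] by (simp add: L.diff single)
  ultimately show "Vector_Spaces.linear sA sT (\<lambda>a. tns a b)" "Vector_Spaces.linear sB sT (tns a)"
    using vs by (auto simp: linear_iff_vs)
qed

lemma tensor_bracket_ex1:
  assumes T: "is_tensor_product sA UNIV sB UNIV sT tns"
    and A: "\<And>x. Vector_Spaces.linear sA sA (mA x)" "\<And>y. Vector_Spaces.linear sA sA (\<lambda>x. mA x y)"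
    and B: "\<And>x. Vector_Spaces.linear sB sB (mB x)" "\<And>y. Vector_Spaces.linear sB sB (\<lambda>x. mB x y)"
  shows "\<exists>!br. is_tensor_bracket sT tns mA mB br"
proof -
  have vs: "vector_space sA" "vector_space sB" "vector_space sT"
    using T by (auto simp: is_tensor_product_def)
  interpret T: vector_space sT by fact
  note bil = tns_bilinear(1)[OF T, unfolded linear_iff_vs[OF vs(1) vs(3)]] tns_bilinear(2)[OF T, unfolded linear_iff_vs[OF vs(2) vs(3)]]
  note A' = A[unfolded linear_iff_vs[OF vs(1) vs(1)]] and B' = B[unfolded linear_iff_vs[OF vs(2) vs(2)]]
  define w where "w a b a' b' = tns (mA a a') (mB b b') - tns (mA a' a) (mB b' b)" for a b a' b'
  have "\<exists>g. Vector_Spaces.linear sT sT g \<and> (\<forall>a' b'. g (tns a' b') = w a b a' b')" for a b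
    by (rule tensor_lift_ex[OF T vs(3)])
       (use vs in \<open>auto simp: linear_iff_vs w_def bil A' B' T.scale_right_diff_distrib algebra_simps\<close>)
  then obtain L where L: "\<And>a b. Vector_Spaces.linear sT sT (L a b)"
    "\<And>a b a' b'. L a b (tns a' b') = w a b a' b'" by metis
  note L' = L(1)[unfolded linear_iff_vs[OF vs(3) vs(3)]]
  have "\<exists>g. Vector_Spaces.linear sT (fun_scale sT) g \<and> (\<forall>a b. g (tns a b) = L a b)"
  proof (rule tensor_lift_ex[OF T vector_space_fun_scale[OF vs(3)]])
    fix b
    have "L (a + a') b = L a b + L a' b" for a a'
      by (rule tensor_ext[OF T, of sT])
         (use vs in \<open>auto simp: linear_iff_vs L w_def bil A' B' L' T.scale_right_diff_distrib algebra_simps\<close>)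
    moreover have "L (sA c a) b = fun_scale sT c (L a b)" for c a
      by (rule tensor_ext[OF T, of sT])
         (use vs in \<open>auto simp: linear_iff_vs fun_scale_def L w_def bil A' B' L' T.scale_right_diff_distrib algebra_simps\<close>)
    ultimately show "Vector_Spaces.linear sA (fun_scale sT) (\<lambda>a. L a b)"
      by (auto simp: linear_iff_vs[OF vs(1) vector_space_fun_scale[OF vs(3)]])
  next
    fix a
    have "L a (b + b') = L a b + L a b'" for b b'
      by (rule tensor_ext[OF T, of sT])
         (use vs in \<open>auto simp: linear_iff_vs L w_def bil A' B' L' T.scale_right_diff_distrib algebra_simps\<close>)
    moreover have "L a (sB c b) = fun_scale sT c (L a b)" for c b
      by (rule tensor_ext[OF T, of sT])
         (use vs in \<open>auto simp: linear_iff_vs fun_scale_def L w_def bil A' B' L' T.scale_right_diff_distrib algebra_simps\<close>)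
    ultimately show "Vector_Spaces.linear sB (fun_scale sT) (L a)"
      by (auto simp: linear_iff_vs[OF vs(2) vector_space_fun_scale[OF vs(3)]])
  qed
  then obtain g where g: "Vector_Spaces.linear sT (fun_scale sT) g" "\<And>a b. g (tns a b) = L a b" by blast
  note g' = g(1)[unfolded linear_iff_vs[OF vs(3) vector_space_fun_scale[OF vs(3)]]]
  have gl: "Vector_Spaces.linear sT sT (\<lambda>x. g x y)" for y
    using g' by (simp add: linear_iff_vs[OF vs(3) vs(3)] fun_scale_def)
  have gr: "Vector_Spaces.linear sT sT (g x)" for x
  proof -
    have "(\<lambda>x. g x (u + v)) = (\<lambda>x. g x u + g x v)" for u v
      by (rule tensor_ext[OF T, of sT])
         (use g' in \<open>auto simp: linear_iff_vs[OF vs(3) vs(3)] g L' fun_scale_def T.scale_right_distrib algebra_simps\<close>)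
    moreover have "(\<lambda>x. g x (sT c u)) = (\<lambda>x. sT c (g x u))" for c u
      by (rule tensor_ext[OF T, of sT])
         (use g' in \<open>auto simp: linear_iff_vs[OF vs(3) vs(3)] g L' fun_scale_def T.scale_right_distrib algebra_simps\<close>)
    ultimately show ?thesis unfolding linear_iff_vs[OF vs(3) vs(3)] by metis
  qed
  show ?thesis
  proof (rule ex1I[of _ g])
    show "is_tensor_bracket sT tns mA mB g"
      unfolding is_tensor_bracket_def using gl gr by (simp add: g L w_def)
  next
    fix br assume br: "is_tensor_bracket sT tns mA mB br"
    have "br (tns a b) = g (tns a b)" for a b
      by (rule tensor_ext[OF T, of sT]) (use br gr in \<open>auto simp: is_tensor_bracket_def g L w_def\<close>)
    then have "(\<lambda>x. br x y) = (\<lambda>x. g x y)" for y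
      by (intro tensor_ext[OF T, of sT]) (use br gl in \<open>auto simp: is_tensor_bracket_def\<close>)
    then show "br = g" by (metis ext)
  qed
qed

lemma magmatic_simps [simp]:
  "scale magmatic_operad = free_scale"
  "relabel magmatic_operad S g p = free_lift free_scale (\<lambda>t. monom (subst (\<lambda>i. Var (g i)) t)) p"
  "pcomp magmatic_operad S i T p q = free_lift free_scale (\<lambda>t.
              free_lift free_scale (\<lambda>u. monom (subst (Var(i := u)) t)) q) p"
  "unit magmatic_operad i = monom (Var i)"
  by (simp_all add: magmatic_operad_def)

lemma piece_magmatic: "p \<in> piece magmatic_operad S \<longleftrightarrow>
  (\<forall>t\<in>Poly_Mapping.keys p. distinct (var_list t) \<and> set (var_list t) = S)"
  by (simp add: magmatic_operad_def)

lemma subst_cong: "(\<And>i. i \<in> set (var_list t) \<Longrightarrow> f i = g i) \<Longrightarrow> subst f t = subst g t"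
  by (induction t) auto
lemma subst_Var [simp]: "subst Var t = t" by (induction t) auto
lemma subst_subst: "subst f (subst g t) = subst (\<lambda>i. subst f (g i)) t" by (induction t) auto
lemma var_list_relabel: "var_list (subst (\<lambda>i. Var (g i)) t) = map g (var_list t)" by (induction t) auto
lemma set_subst: "set (var_list (subst f t)) = (\<Union>i\<in>set (var_list t). set (var_list (f i)))" by (induction t) auto
lemma distinct_subst: "distinct (var_list t) \<Longrightarrow> (\<And>i. i \<in> set (var_list t) \<Longrightarrow> distinct (var_list (f i))) \<Longrightarrow>
  (\<And>i j. i \<in> set (var_list t) \<Longrightarrow> j \<in> set (var_list t) \<Longrightarrow> i \<noteq> j \<Longrightarrow> set (var_list (f i)) \<inter> set (var_list (f j)) = {}) \<Longrightarrow>
  distinct (var_list (subst f t))"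
proof (induction t)
  case (Mult t u)
  have "set (var_list (subst f t)) \<inter> set (var_list (subst f u)) = {}"
    using Mult.prems(1) Mult.prems(3) unfolding set_subst by (simp add: disjoint_iff) metis
  then show ?case using Mult by simp
qed auto

lemma operad_magmatic: "operad (magmatic_operad :: ('k::field, _) operad_data)"
proof -
  note vs = vector_space_free_scale[where 'k='k and 'x=monomial]
  note L = free_lift_add[OF vs] free_lift_scale[OF vs] free_lift_lift[OF vs]
  interpret F: vector_space "free_scale :: 'k \<Rightarrow> (monomial \<Rightarrow>\<^sub>0 'k) \<Rightarrow> _" by (rule vs)
  show ?thesis
  proof (unfold_locales, goal_cases)
    case (5 S)
    show ?case unfolding F.subspace_def magmatic_simps piece_magmatic
      by (auto dest!: subsetD[OF keys_add] simp: piece_magmatic) (auto simp: in_keys_iff)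
  next
    case (6 S f p)
    show ?case unfolding piece_magmatic magmatic_simps
      using 6(2,3)
      by (auto dest!: subsetD[OF keys_free_lift] simp: piece_magmatic var_list_relabel distinct_map)
  next
    case (7 S f) then show ?case by (simp add: linear_on_def L)
  next
    case (8 S f p g) then show ?case
      by (auto intro!: free_lift_cong arg_cong[where f=monom] subst_cong simp: piece_magmatic)
  next
    case (9 S p) then show ?case by simp
  next
    case (10 S f g p) then show ?case by (simp add: L subst_subst)
  next
    case (11 i) then show ?case by (simp add: piece_magmatic)
  next
    case (12 i f) then show ?case by simp
  next
    case (13 S i T p q)
    show ?case unfolding piece_magmatic
    proof
      fix v assume "v \<in> Poly_Mapping.keys (pcomp magmatic_operad S i T p q)"
      then obtain t u where tu: "t \<in> Poly_Mapping.keys p" "u \<in> Poly_Mapping.keys q" and v: "v = subst (Var(i := u)) t"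
        by (auto dest!: subsetD[OF keys_free_lift])
      have "distinct (var_list t)" "set (var_list t) = S" "distinct (var_list u)" "set (var_list u) = T"
        using 13 tu by (auto simp: piece_magmatic)
      with 13(1) show "distinct (var_list v) \<and> set (var_list v) = S - {i} \<union> T"
        unfolding v by (auto simp: set_subst composable_def intro!: distinct_subst split: if_splits)
    qed
  next
    case (14 S i T q) then show ?case by (simp add: linear_on_def L)
  next
    case (15 S i T p)
    have "free_lift free_scale (\<lambda>t. f t + g t) p = free_lift free_scale f p + free_lift free_scale g p"
      for f g :: "monomial \<Rightarrow> monomial \<Rightarrow>\<^sub>0 'k"
      by (simp add: free_lift_def F.scale_right_distrib sum.distrib)
    moreover have "free_lift free_scale (\<lambda>t. free_scale c (f t)) p = free_scale c (free_lift free_scale f p)"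
      for f :: "monomial \<Rightarrow> monomial \<Rightarrow>\<^sub>0 'k" and c
      by (simp add: free_lift_def F.scale_sum_right mult.commute)
    ultimately show ?case by (simp add: linear_on_def L)
  next
    case (16 T q i) then show ?case by simp
  next
    case (17 S i p) then show ?case by simp
  next
    case (18 S i T j U p q r)
    have "subst (Var(j := v)) (subst (Var(i := u)) t) = subst (Var(i := subst (Var(j := v)) u)) t"
      if "t \<in> Poly_Mapping.keys p" for t u v
      unfolding subst_subst
    proof (rule subst_cong)
      fix k assume "k \<in> set (var_list t)"
      then have "k \<in> S" using that 18(4) by (auto simp: piece_magmatic)
      moreover have "j \<notin> S - {i}" using 18(1,2) by (auto simp: composable_def)
      ultimately show "subst (Var(j := v)) ((Var(i := u)) k) = (Var(i := subst (Var(j := v)) u)) k" by auto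
    qed
    then show ?case by (auto simp: L intro!: free_lift_cong)
  next
    case (19 S i T j U p q r)
    have "subst (Var(j := v)) (subst (Var(i := u)) t) = subst (Var(i := u)) (subst (Var(j := v)) t)"
      if "t \<in> Poly_Mapping.keys p" "u \<in> Poly_Mapping.keys q" "v \<in> Poly_Mapping.keys r" for t u v
    proof -
      have ij: "j \<notin> T" "i \<notin> U" using 19(1-3) by (auto simp: composable_def)
      have "set (var_list u) = T" "set (var_list v) = U" using that(2,3) 19(6,7) by (auto simp: piece_magmatic)
      with ij have "subst (Var(j := v)) u = subst Var u" "subst (Var(i := u)) v = subst Var v"
        by (auto intro!: subst_cong simp del: subst_Var)
      then have "subst (Var(j := v)) u = u" "subst (Var(i := u)) v = v" by simp_all
      then show ?thesis
        unfolding subst_subst by (intro subst_cong) (use 19(3) in auto)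
    qed
    then show ?case
      apply (simp add: L)
      apply (rule free_lift_cong)
      apply (subst free_lift_swap[OF vs])
      apply (auto intro!: free_lift_cong)
      done
  next
    case (20 S i T f g p q)
    have "subst (Var(f i := subst (\<lambda>i. Var (g i)) u)) (subst (\<lambda>i. Var (f i)) t) =
      subst (\<lambda>x. Var (if x \<in> T then g x else f x)) (subst (Var(i := u)) t)"
      if "t \<in> Poly_Mapping.keys p" "u \<in> Poly_Mapping.keys q" for t u
    proof -
      have S: "set (var_list t) = S" and T: "set (var_list u) = T" using that 20(5,6) by (auto simp: piece_magmatic)
      have "subst (\<lambda>i. Var (g i)) u = subst (\<lambda>x. Var (if x \<in> T then g x else f x)) u"
        by (rule subst_cong) (simp add: T)
      then show ?thesis unfolding subst_subst
        by (intro subst_cong) (use S 20(1,2) in \<open>auto simp: composable_def inj_on_def\<close>)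
    qed
    then show ?case by (auto simp: L intro!: free_lift_cong)
  qed (auto simp: F.scale_right_distrib F.scale_left_distrib)
qed

lemma End_operad_simps [simp]:
  "scale (End_operad s) = fun_scale s"
  "relabel (End_operad s) S g f = (\<lambda>x. f (\<lambda>i. x (g i)))"
  "pcomp (End_operad s) S i T f h = (\<lambda>x. f (x(i := h x)))"
  "unit (End_operad s) i = (\<lambda>x. x i)"
  by (auto simp: End_operad_def)

lemma piece_End:
  "f \<in> piece (End_operad s) S \<longleftrightarrow>
    (\<forall>x y. (\<forall>i\<in>S. x i = y i) \<longrightarrow> f x = f y) \<and>
    (\<forall>i\<in>S. \<forall>x. Vector_Spaces.linear s s (\<lambda>a. f (x(i := a))))"
  by (auto simp: End_operad_def)

lemma End_dep: "f \<in> piece (End_operad s) S \<Longrightarrow> (\<And>i. i \<in> S \<Longrightarrow> x i = y i) \<Longrightarrow> f x = f y"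
  by (auto simp: piece_End)

lemma End_lin: "f \<in> piece (End_operad s) S \<Longrightarrow> i \<in> S \<Longrightarrow> vector_space s \<Longrightarrow>
   f (x(i := a + b)) = f (x(i := a)) + f (x(i := b)) \<and> f (x(i := s c a)) = s c (f (x(i := a)))"
  by (auto simp: piece_End linear_iff_vs)

lemma End_I: assumes "vector_space s"
  "\<And>x y. (\<And>i. i\<in>S \<Longrightarrow> x i = y i) \<Longrightarrow> f x = f y"
  "\<And>i x a b. i \<in> S \<Longrightarrow> f (x(i := a + b)) = f (x(i := a)) + f (x(i := b))"
  "\<And>i x a c. i \<in> S \<Longrightarrow> f (x(i := s c a)) = s c (f (x(i := a)))"
  shows "f \<in> piece (End_operad s) S"
proof -
  have "f x = f y" if "\<forall>i\<in>S. x i = y i" for x y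
    by (rule assms(2)) (use that in blast)
  then show ?thesis unfolding piece_End linear_iff_vs[OF assms(1) assms(1)]
    using assms(3,4) by blast
qed

lemma operad_End:
  fixes s :: "'k::field \<Rightarrow> 'a::ab_group_add \<Rightarrow> 'a"
  assumes vs: "vector_space s"
  shows "operad (End_operad s)"
proof -
  note vsF = vector_space_fun_scale[OF vs, where 'x="nat \<Rightarrow> 'a"]
  show ?thesis
proof (unfold_locales, goal_cases)
  case (1 a x y) then show ?case using vsF by (simp add: vector_space_def)
next
  case (2 a x y) then show ?case using vsF by (simp add: vector_space_def)
next
  case (3 a x y) then show ?case using vsF by (simp add: vector_space_def)
next
  case (4 a) then show ?case using vsF by (simp add: vector_space_def)
next
  case (5 S)
  interpret vector_space s by fact
  interpret F: vector_space "fun_scale s :: 'k \<Rightarrow> ((nat \<Rightarrow> 'a) \<Rightarrow> 'a) \<Rightarrow> _" by (rule vsF)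
  have z: "0 \<in> piece (End_operad s) S"
    by (intro End_I vs) auto
  have a: "f + g \<in> piece (End_operad s) S" if "f \<in> piece (End_operad s) S" "g \<in> piece (End_operad s) S" for f g
    apply (intro End_I vs)
    subgoal for x y using End_dep[OF that(1), of x y] End_dep[OF that(2), of x y] by simp
    by (auto simp: End_lin[OF that(1) _ vs] End_lin[OF that(2) _ vs] algebra_simps)
  have c: "fun_scale s k f \<in> piece (End_operad s) S" if "f \<in> piece (End_operad s) S" for f k
    apply (intro End_I vs)
    subgoal for x y using End_dep[OF that(1), of x y] by (simp add: fun_scale_def)
    by (auto simp: fun_scale_def End_lin[OF that(1) _ vs] algebra_simps)
  show ?case unfolding F.subspace_def End_operad_simps using z a c by auto
next
  case (6 S f p)
  have upd: "p (\<lambda>i. (x(f j := a)) (f i)) = p ((\<lambda>i. x (f i))(j := a))" if "j \<in> S" for x j a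
    by (rule End_dep[OF 6(3)]) (use 6(2) that in \<open>auto simp: inj_on_def\<close>)
  show ?case
    apply (intro End_I vs)
      apply (auto simp del: fun_upd_apply simp: upd End_lin[OF 6(3) _ vs])
    by (rule End_dep[OF 6(3)]) auto
next
  case (7 S f) then show ?case by (auto simp: linear_on_def fun_scale_def)
next
  case (8 S f p g) show ?case unfolding End_operad_simps by (rule ext, rule End_dep[OF 8(3)]) (use 8(4) in simp)
next
  case (9 S p) then show ?case by simp
next
  case (10 S f g p) then show ?case by simp
next
  case (11 i) then show ?case by (intro End_I vs) auto
next
  case (12 i f) then show ?case by simp
next
  case (13 S i T p q)
  have i: "i \<in> S" "(S - {i}) \<inter> T = {}" using 13(1) by (auto simp: composable_def)
  have e1: "p ((x(j := a))(i := v)) = p (x(i := v))" if "j \<in> T" for j x a v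
    by (rule End_dep[OF 13(2)]) (use that i in auto)
  have e2: "p ((x(j := a))(i := q (x(j := a)))) = p ((x(i := q x))(j := a))" if "j \<in> S - {i}" for j x a
  proof -
    have "q (x(j := a)) = q x" by (rule End_dep[OF 13(3)]) (use that i in auto)
    moreover have "j \<noteq> i" using that by auto
    ultimately show ?thesis by (simp add: fun_upd_twist)
  qed
  show ?case
  proof (intro End_I vs)
    fix x y :: "nat \<Rightarrow> 'a" assume *: "\<And>j. j \<in> S - {i} \<union> T \<Longrightarrow> x j = y j"
    have "q x = q y" by (rule End_dep[OF 13(3)]) (use * in auto)
    then show "pcomp (End_operad s) S i T p q x = pcomp (End_operad s) S i T p q y"
      using * by (auto intro!: End_dep[OF 13(2)])
  next
    fix j x a b assume "j \<in> S - {i} \<union> T"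
    then consider "j \<in> T" | "j \<in> S - {i}" by auto
    then show "pcomp (End_operad s) S i T p q (x(j := a + b)) =
          pcomp (End_operad s) S i T p q (x(j := a)) + pcomp (End_operad s) S i T p q (x(j := b))"
    proof cases
      case 1 then show ?thesis using i(1) by (simp only: End_operad_simps e1[OF 1] End_lin[OF 13(3) _ vs] End_lin[OF 13(2) _ vs])
    next
      case 2 then have "j \<in> S" by auto
      then show ?thesis using End_lin[OF 13(2) _ vs] by (simp only: End_operad_simps e2[OF 2])
    qed
  next
    fix j x a c assume "j \<in> S - {i} \<union> T"
    then consider "j \<in> T" | "j \<in> S - {i}" by auto
    then show "pcomp (End_operad s) S i T p q (x(j := s c a)) =
          s c (pcomp (End_operad s) S i T p q (x(j := a)))"
    proof cases
      case 1 then show ?thesis using i(1) by (simp only: End_operad_simps e1[OF 1] End_lin[OF 13(3) _ vs] End_lin[OF 13(2) _ vs])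
    next
      case 2 then have "j \<in> S" by auto
      then show ?thesis using End_lin[OF 13(2) _ vs] by (simp only: End_operad_simps e2[OF 2])
    qed
  qed
next
  case (14 S i T q) then show ?case by (auto simp: linear_on_def fun_scale_def)
next
  case (15 S i T p) then show ?case using End_lin[OF 15(2) _ vs] by (auto simp: linear_on_def fun_scale_def composable_def fun_eq_iff)
next
  case (16 T q i) then show ?case by simp
next
  case (17 S i p) then show ?case by simp
next
  case (18 S i T j U p q r)
  show ?case
  proof
    fix x
    have "q ((x(j := r x))) = q (x(j := r x))" ..
    show "pcomp (End_operad s) (S - {i} \<union> T) j U (pcomp (End_operad s) S i T p q) r x =
         pcomp (End_operad s) S i (T - {j} \<union> U) p (pcomp (End_operad s) T j U q r) x"
      unfolding End_operad_simps
      by (rule End_dep[OF 18(4)]) (use 18(1,2) in \<open>auto simp: composable_def\<close>)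
  qed
next
  case (19 S i T j U p q r)
  show ?case
  proof
    fix x
    have 1: "q (x(j := r x)) = q x" by (rule End_dep[OF 19(6)]) (use 19 in \<open>auto simp: composable_def\<close>)
    have 2: "r (x(i := q x)) = r x" by (rule End_dep[OF 19(7)]) (use 19 in \<open>auto simp: composable_def\<close>)
    show "pcomp (End_operad s) (S - {i} \<union> T) j U (pcomp (End_operad s) S i T p q) r x =
         pcomp (End_operad s) (S - {j} \<union> U) i T (pcomp (End_operad s) S j U p r) q x"
      unfolding End_operad_simps 1 2 using 19(3) by (simp add: fun_upd_twist)
  qed
next
  case (20 S i T f g p q)
  show ?case
  proof
    fix x
    have 1: "q (\<lambda>k. x (if k \<in> T then g k else f k)) = q (\<lambda>k. x (g k))" by (rule End_dep[OF 20(6)]) auto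
    show "pcomp (End_operad s) (f ` S) (f i) (g ` T) (relabel (End_operad s) S f p) (relabel (End_operad s) T g q) x =
         relabel (End_operad s) (S - {i} \<union> T) (\<lambda>x. if x \<in> T then g x else f x) (pcomp (End_operad s) S i T p q) x"
      unfolding End_operad_simps 1
      by (rule End_dep[OF 20(5)]) (use 20(1,2,4) in \<open>auto simp: composable_def inj_on_def\<close>)
  qed
qed
qed

end

theory Submission
  imports Defs
begin

text \<open>Write an endomorphism of \<open>A \<otimes> B\<close> as \<open>\<Sum>\<^sub>i \<phi>\<^sub>i \<otimes> \<psi>\<^sub>i\<close>.  Since \<open>A\<close> is commutative and \<open>B\<close> is
  anticommutative, the bracket on pure tensors is \<open>2 (aa' \<otimes> bb')\<close>, so that the Hom-Lie condition
  says that the cyclic sum of the tensors \<open>(ab)\<phi>\<^sub>i(c) \<otimes> (a'b')\<psi>\<^sub>i(c')\<close> vanishes.  Permuting \<open>a, b, c\<close>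
  while \<open>a', b', c'\<close> stay fixed, this is equivalent to two conditions: the tensors of the defects
  measuring the failure of \<open>\<phi>\<^sub>i\<close>, \<open>\<psi>\<^sub>i\<close> to lie in \<open>HomLie\<close> sum to zero, and likewise for \<open>HomCycl\<close>.
  Taking the \<open>\<phi>\<^sub>i\<close> from a basis of \<open>End(A)\<close> adapted to \<open>HomLie(A)\<close>, \<open>HomCycl(A)\<close> and their
  intersection \<open>Hom2Nilp(A)\<close> (characteristic \<open>\<noteq> 3\<close>), linear independence of the defects puts every
  \<open>\<psi>\<^sub>i\<close> into the subspace required by its \<open>\<phi>\<^sub>i\<close>.\<close>

section \<open>Adapted bases, functionals and coordinates in a vector space\<close>

section \<open>Linear algebra\<close>

lemma sum_fun_apply: "(\<Sum>i\<in>I. f i) x = (\<Sum>i\<in>I. f i x)"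
  by (induction I rule: infinite_finite_induct) auto

lemma vector_space_field: "vector_space ((*) :: 'k::field \<Rightarrow> 'k \<Rightarrow> 'k)"
  by unfold_locales (auto simp: algebra_simps)

context vector_space
begin

text \<open>The coordinates of \<open>v\<close> over \<open>B \<union> C\<close> extend both those
  over \<open>B\<close> and those over \<open>C\<close>, so their support lies in
  \<open>B \<inter> C = {}\<close>.\<close>

lemma span_Int_span_disjoint:
  assumes "independent (B \<union> C)" "B \<inter> C = {}" "v \<in> span B" "v \<in> span C"
  shows "v = 0"
proof -
  have v: "v \<in> span (B \<union> C)"
    using assms(3) span_mono[of B "B \<union> C"] by blast
  have "representation (B \<union> C) v b = 0" for b
  proof -
    have "representation (B \<union> C) v = representation B v" "representation (B \<union> C) v = representation C v"
      using assms by (auto intro!: representation_extend)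
    then show ?thesis
      using representation_ne_zero[of B v b] representation_ne_zero[of C v b] assms(2) by auto
  qed
  then show ?thesis
    using sum_nonzero_representation_eq[OF assms(1) v] by simp
qed

text \<open>\<open>B\<^sub>0\<close> is a basis of \<open>U \<inter> W\<close>;
  \<open>B\<^sub>1\<close> extends it to a basis of \<open>U\<close>, vectors
  \<open>B\<^sub>2\<close> of \<open>W\<close> extend this to a basis of \<open>U + W\<close>, and
  \<open>B\<^sub>3\<close> completes it to one of \<open>V\<close>. The last two conclusions make a
  linear map with kernel \<open>U\<close>, respectively \<open>W\<close>, injective on the span of
  the basis vectors not placed in its kernel.\<close>

lemma adapted_basis:
  assumes "subspace U" "subspace W" "subspace V" "U \<subseteq> V" "W \<subseteq> V"
  obtains B\<^sub>0 B\<^sub>1 B\<^sub>2 B\<^sub>3 where "independent (B\<^sub>0 \<union> B\<^sub>1 \<union> B\<^sub>2 \<union> B\<^sub>3)" "span (B\<^sub>0 \<union> B\<^sub>1 \<union> B\<^sub>2 \<union> B\<^sub>3) = V"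
    "B\<^sub>0 \<subseteq> U \<inter> W" "B\<^sub>1 \<subseteq> U" "B\<^sub>2 \<subseteq> W"
    "U \<inter> span (B\<^sub>2 \<union> B\<^sub>3) = {0}" "W \<inter> span (B\<^sub>1 \<union> B\<^sub>3) = {0}"
proof -
  obtain B where B: "B \<subseteq> U \<inter> W" "independent B" "U \<inter> W \<subseteq> span B"
    using maximal_independent_subset by blast
  obtain C where C: "B \<subseteq> C" "C \<subseteq> U" "independent C" "U \<subseteq> span C"
    using maximal_independent_subset_extend[of B U] B by auto
  obtain D where D: "C \<subseteq> D" "D \<subseteq> C \<union> W" "independent D" "C \<union> W \<subseteq> span D"
    using maximal_independent_subset_extend[of C "C \<union> W"] C by auto
  have "D \<subseteq> V"
    using D(2) C(2) assms(4,5) by blast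
  then obtain E where E: "D \<subseteq> E" "E \<subseteq> V" "independent E" "V \<subseteq> span E"
    using maximal_independent_subset_extend[of D V] D(3) by blast
  let ?B1 = "C - B" and ?B2 = "D - C" and ?B3 = "E - D"
  have sets: "B \<union> ?B1 \<union> ?B2 \<union> ?B3 = E" "?B2 \<union> ?B3 = E - C" "B \<union> ?B2 \<union> ?B1 = D" "D \<union> ?B3 = E"
    "C \<union> (E - C) = E" "B \<union> ?B2 \<union> (?B1 \<union> ?B3) = E"
    using C(1) D(1) E(1) by blast+
  have "v = 0" if "v \<in> U" "v \<in> span (E - C)" for v
    by (rule span_Int_span_disjoint[of C "E - C"]) (use that C(4) E(3) sets(5) in auto)
  \<comment> \<open>\<open>D\<close> was extended from \<open>C\<close>, not from \<open>B\<close>,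
    so it takes an argument that \<open>B \<union> ?B2\<close> spans \<open>W\<close>: the part
    \<open>u\<close> along \<open>?B1\<close> of a vector of \<open>W\<close> lies in
    \<open>U \<inter> W\<close>, hence in \<open>span B\<close>.\<close>
  moreover have "v = 0" if v: "v \<in> W" "v \<in> span (?B1 \<union> ?B3)" for v
  proof -
    have "v \<in> span (?B1 \<union> (B \<union> ?B2))"
      using v(1) D(4) sets(3) by (auto simp: Un_commute)
    then obtain u w where uw: "v = u + w" "u \<in> span ?B1" "w \<in> span (B \<union> ?B2)"
      unfolding span_Un by auto
    have "w \<in> W"
      using uw(3) span_minimal[OF _ assms(2), of "B \<union> ?B2"] B(1) D(2) by auto
    then have "u \<in> W"
      using v(1) uw(1) subspace_diff[OF assms(2), of v w] by simp
    moreover have "u \<in> U"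
      using uw(2) span_minimal[OF _ assms(1), of ?B1] C(2) by auto
    ultimately have "u \<in> span B"
      using B(3) by auto
    then have "u \<in> span (B \<union> ?B2)"
      using span_mono[of B "B \<union> ?B2"] by blast
    then have "v \<in> span (B \<union> ?B2)"
      unfolding uw(1) using uw(3) by (rule span_add)
    moreover have "(B \<union> ?B2) \<inter> (?B1 \<union> ?B3) = {}"
      using C(1) D(1) by blast
    ultimately show ?thesis
      using span_Int_span_disjoint[of "B \<union> ?B2" "?B1 \<union> ?B3" v] E(3) v(2) sets(6) by metis
  qed
  ultimately have "U \<inter> span (E - C) = {0}" "W \<inter> span (?B1 \<union> ?B3) = {0}"
    using subspace_0[OF assms(1)] subspace_0[OF assms(2)] span_zero by blast+
  moreover have "span E = V"
    using span_minimal[OF E(2) assms(3)] E(4) by blast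
  ultimately show ?thesis
    using that[of B ?B1 ?B2 ?B3, unfolded sets(1,2)] B(1) C(2) D(2) E(3) by blast
qed

lemma separating_functional:
  assumes "x \<noteq> 0"
  obtains g where "Vector_Spaces.linear scale (*) g" "g x \<noteq> 0"
proof -
  interpret K: vector_space "(*) :: 'a \<Rightarrow> 'a \<Rightarrow> 'a"
    by (rule vector_space_field)
  interpret P: vector_space_pair scale "(*) :: 'a \<Rightarrow> 'a \<Rightarrow> 'a" ..
  obtain g where "Vector_Spaces.linear scale (*) g" "g x = 1"
    using P.linear_independent_extend[of "{x}" "\<lambda>_. 1"] assms by auto
  then show ?thesis
    using that by auto
qed

lemma finite_coordinates:
  assumes "finite X" "span X = UNIV"
  obtains I c where "finite I" "\<And>i. Vector_Spaces.linear scale (*) (c i)" "\<And>v. v = (\<Sum>i\<in>I. c i v *s i)"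
proof -
  obtain B where B: "B \<subseteq> X" "independent B" "X \<subseteq> span B"
    using maximal_independent_subset by blast
  have fin: "finite B" and sp: "span B = UNIV"
    using B assms finite_subset span_minimal[OF B(3) subspace_span] by auto
  show ?thesis
  proof (rule that[of B "\<lambda>b v. representation B v b"])
    show "Vector_Spaces.linear scale (*) (\<lambda>v. representation B v b)" for b
      using B(2) sp by (auto simp: linear_iff_vs[OF vector_space_axioms vector_space_field] representation_add representation_scale)
  qed (use fin B(2) sp in \<open>auto simp: sum_representation_eq\<close>)
qed

end

section \<open>Universal property, expansions and independence in tensor products of
  subspaces\<close>

section \<open>Tensor products\<close>

text \<open>The universal property for subspaces \<open>U\<close> and \<open>V\<close>, needed
  because \<open>End sA\<close> and \<open>End sB\<close> are subspaces of function types. The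
  extension \<open>?F\<close> of \<open>f\<close> to the free space kills the bilinearity relations,
  hence the kernel of \<open>?L\<close>, and so factors through \<open>?L\<close>.\<close>

lemma tensor_lift_on:
  assumes T: "is_tensor_product sA U sB V sT tns" and C: "vector_space sC"
    and add_left: "\<And>a a' b. a \<in> U \<Longrightarrow> a' \<in> U \<Longrightarrow> b \<in> V \<Longrightarrow> f (a + a') b = f a b + f a' b"
    and add_right: "\<And>a b b'. a \<in> U \<Longrightarrow> b \<in> V \<Longrightarrow> b' \<in> V \<Longrightarrow> f a (b + b') = f a b + f a b'"
    and scale_left: "\<And>c a b. a \<in> U \<Longrightarrow> b \<in> V \<Longrightarrow> f (sA c a) b = sC c (f a b)"
    and scale_right: "\<And>c a b. a \<in> U \<Longrightarrow> b \<in> V \<Longrightarrow> f a (sB c b) = sC c (f a b)"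
  obtains g where "Vector_Spaces.linear sT sC g" "\<And>a b. a \<in> U \<Longrightarrow> b \<in> V \<Longrightarrow> g (tns a b) = f a b"
proof -
  let ?L = "free_lift sT (\<lambda>(a, b). tns a b)" and ?F = "free_lift sC (\<lambda>(a, b). f a b)"
  let ?K = "{x. Poly_Mapping.keys x \<subseteq> U \<times> V}"
  have vs: "vector_space sA" "vector_space sB" "vector_space sT"
    and onto: "?L ` ?K = UNIV"
    and ker: "{x. Poly_Mapping.keys x \<subseteq> U \<times> V \<and> ?L x = 0} = module.span free_scale (tensor_relations sA U sB V)"
    using T by (auto simp: is_tensor_product_def)
  note add = free_lift_add[OF vs(3)] free_lift_add[OF C] and sc = free_lift_scale[OF vs(3)] free_lift_scale[OF C]
    and single = free_lift_single[OF vs(3)] free_lift_single[OF C]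
  interpret L: Vector_Spaces.linear free_scale sT ?L by (rule free_lift_linear[OF vs(3)])
  interpret F: Vector_Spaces.linear free_scale sC ?F by (rule free_lift_linear[OF C])
  have rel: "?F x = 0" if "x \<in> tensor_relations sA U sB V" for x
    using that unfolding tensor_relations_def
    by (auto simp: F.diff single vector_space_simps[OF C] add_left add_right scale_left scale_right)
  have F0: "?F x = 0" if "x \<in> ?K" "?L x = 0" for x
  proof -
    have "x \<in> module.span free_scale (tensor_relations sA U sB V)" using that ker by auto
    with rel show ?thesis by (rule F.eq_0_on_span)
  qed
  \<comment> \<open>A preimage under \<open>?L\<close> supported on \<open>U \<times> V\<close>. By
    \<open>F0\<close> the value of \<open>?F\<close> does not depend on which such preimage is
    chosen.\<close>
  define r where "r t = (SOME x. x \<in> ?K \<and> ?L x = t)" for t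
  have r: "r t \<in> ?K" "?L (r t) = t" for t
  proof -
    have "\<exists>x. x \<in> ?K \<and> ?L x = t" using onto by (metis (no_types, lifting) UNIV_I imageE)
    then have "r t \<in> ?K \<and> ?L (r t) = t" unfolding r_def by (rule someI_ex)
    then show "r t \<in> ?K" "?L (r t) = t" by blast+
  qed
  define g where "g t = ?F (r t)" for t
  have K_add: "x + y \<in> ?K" and K_diff: "x - y \<in> ?K" if "x \<in> ?K" "y \<in> ?K" for x y
    using that keys_add[of x y] keys_diff[of x y] by auto
  have K_sc: "free_scale c x \<in> ?K" if "x \<in> ?K" for x c
    using that by (auto simp: in_keys_iff)
  have g: "g (?L x) = ?F x" if "x \<in> ?K" for x
  proof -
    have "?L (r (?L x) - x) = 0" by (simp add: L.diff r)
    then have "?F (r (?L x) - x) = 0" using K_diff r(1) that by (intro F0) auto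
    then show ?thesis by (simp add: g_def F.diff)
  qed
  have "g (x + y) = g x + g y" for x y
    using g[OF K_add[OF r(1) r(1)], of x y] by (simp add: add r g_def)
  moreover have "g (sT c x) = sC c (g x)" for c x
    using g[OF K_sc[OF r(1)], of c x] by (simp add: sc r g_def)
  moreover have "g (tns a b) = f a b" if "a \<in> U" "b \<in> V" for a b
    using g[of "Poly_Mapping.single (a,b) 1"] that
    by (simp add: single vector_space_simps[OF vs(3)] vector_space_simps[OF C])
  ultimately show ?thesis using that[of g] linear_iff_vs[OF vs(3) C] by blast
qed

lemma tns_bilinear_on:
  assumes T: "is_tensor_product sA U sB V sT tns"
  shows "a \<in> U \<Longrightarrow> a' \<in> U \<Longrightarrow> b \<in> V \<Longrightarrow> tns (a + a') b = tns a b + tns a' b"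
    and "a \<in> U \<Longrightarrow> b \<in> V \<Longrightarrow> b' \<in> V \<Longrightarrow> tns a (b + b') = tns a b + tns a b'"
    and "a \<in> U \<Longrightarrow> b \<in> V \<Longrightarrow> tns (sA c a) b = sT c (tns a b)"
    and "a \<in> U \<Longrightarrow> b \<in> V \<Longrightarrow> tns a (sB c b) = sT c (tns a b)"
proof -
  let ?L = "free_lift sT (\<lambda>(a, b). tns a b)"
  have vs: "vector_space sA" "vector_space sB" "vector_space sT"
    and ker: "{x. Poly_Mapping.keys x \<subseteq> U \<times> V \<and> ?L x = 0} = module.span free_scale (tensor_relations sA U sB V)"
    using T by (auto simp: is_tensor_product_def)
  interpret L: Vector_Spaces.linear free_scale sT ?L by (rule free_lift_linear[OF vs(3)])
  have 0: "?L x = 0" if "x \<in> tensor_relations sA U sB V" for x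
    using ker that L.vs1.span_base by blast
  note single = free_lift_single[OF vs(3)] vector_space_simps[OF vs(3)]
  show "tns (a + a') b = tns a b + tns a' b" if "a \<in> U" "a' \<in> U" "b \<in> V"
  proof -
    have "Poly_Mapping.single (a + a', b) 1 - Poly_Mapping.single (a, b) 1 - Poly_Mapping.single (a', b) 1
      \<in> tensor_relations sA U sB V" unfolding tensor_relations_def using that by blast
    from 0[OF this] show ?thesis by (simp add: L.diff single diff_eq_eq add.commute)
  qed
  show "tns a (b + b') = tns a b + tns a b'" if "a \<in> U" "b \<in> V" "b' \<in> V"
  proof -
    have "Poly_Mapping.single (a, b + b') 1 - Poly_Mapping.single (a, b) 1 - Poly_Mapping.single (a, b') 1
      \<in> tensor_relations sA U sB V" unfolding tensor_relations_def using that by blast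
    from 0[OF this] show ?thesis by (simp add: L.diff single diff_eq_eq add.commute)
  qed
  show "tns (sA c a) b = sT c (tns a b)" if "a \<in> U" "b \<in> V"
  proof -
    have "Poly_Mapping.single (sA c a, b) 1 - Poly_Mapping.single (a, b) c
      \<in> tensor_relations sA U sB V" unfolding tensor_relations_def using that by blast
    from 0[OF this] show ?thesis by (simp add: L.diff single)
  qed
  show "tns a (sB c b) = sT c (tns a b)" if "a \<in> U" "b \<in> V"
  proof -
    have "Poly_Mapping.single (a, sB c b) 1 - Poly_Mapping.single (a, b) c
      \<in> tensor_relations sA U sB V" unfolding tensor_relations_def using that by blast
    from 0[OF this] show ?thesis by (simp add: L.diff single)
  qed
qed

lemma span_pure_tensors:
  assumes T: "is_tensor_product sA U sB V sT tns"
  shows "module.span sT {tns a b | a b. a \<in> U \<and> b \<in> V} = UNIV"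
proof (rule UNIV_eq_I[symmetric])
  fix t
  interpret vector_space sT using T by (simp add: is_tensor_product_def)
  obtain x where x: "Poly_Mapping.keys x \<subseteq> U \<times> V" "t = free_lift sT (\<lambda>(a, b). tns a b) x"
    using T unfolding is_tensor_product_def by (metis (no_types, lifting) UNIV_I imageE mem_Collect_eq)
  show "t \<in> span {tns a b | a b. a \<in> U \<and> b \<in> V}"
    unfolding x(2) free_lift_def using x(1) by (intro span_sum span_scale span_base) auto
qed

text \<open>Splitting left factors along \<open>I\<close> and collecting terms leaves one
  coefficient in \<open>V\<close> for each element of \<open>I\<close>. The tensors with such an
  expansion include the pure ones and are closed under sums and scalar multiples.\<close>

lemma tensor_basis_expansion:
  assumes T: "is_tensor_product sA U sB V sT tns" and I: "module.span sA I = U"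
  obtains J f where "finite J" "J \<subseteq> I" "\<And>i. f i \<in> V" "t = (\<Sum>i\<in>J. tns i (f i))"
proof -
  interpret A: vector_space sA using T by (simp add: is_tensor_product_def)
  interpret B: vector_space sB using T by (simp add: is_tensor_product_def)
  interpret T: vector_space sT using T by (simp add: is_tensor_product_def)
  have U: "A.subspace U" and V: "B.subspace V" using T by (auto simp: is_tensor_product_def)
  note bil = tns_bilinear_on[OF T]
  have IU: "I \<subseteq> U" using I A.span_base by blast
  have tns0: "tns a 0 = 0" if "a \<in> U" for a
    using bil(4)[OF that B.subspace_0[OF V], of 0] by simp
  \<comment> \<open>Letting \<open>f\<close> vanish off \<open>J\<close> allows two expansions to be
    padded with zero terms to \<open>J \<union> J'\<close> and then added.\<close>
  define R where "R t \<longleftrightarrow> (\<exists>J f. finite J \<and> J \<subseteq> I \<and> (\<forall>i. f i \<in> V) \<and> (\<forall>i. i \<notin> J \<longrightarrow> f i = 0) \<and>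
    t = (\<Sum>i\<in>J. tns i (f i)))" for t
  have R0: "R 0"
    unfolding R_def using B.subspace_0[OF V] by (intro exI[of _ "{}"] exI[of _ "\<lambda>_. 0"]) auto
  have R_add: "R (t + t')" if tt: "R t" "R t'" for t t'
  proof -
    obtain J f where J: "finite J" "J \<subseteq> I" "\<And>i. f i \<in> V" "\<And>i. i \<notin> J \<Longrightarrow> f i = 0" "t = (\<Sum>i\<in>J. tns i (f i))"
      using tt(1) unfolding R_def by blast
    obtain J' f' where J': "finite J'" "J' \<subseteq> I" "\<And>i. f' i \<in> V" "\<And>i. i \<notin> J' \<Longrightarrow> f' i = 0" "t' = (\<Sum>i\<in>J'. tns i (f' i))"
      using tt(2) unfolding R_def by blast
    have t: "t = (\<Sum>i\<in>J \<union> J'. tns i (f i))" unfolding J(5)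
      by (rule sum.mono_neutral_left) (use J J' IU in \<open>auto intro!: tns0\<close>)
    have t': "t' = (\<Sum>i\<in>J \<union> J'. tns i (f' i))" unfolding J'(5)
      by (rule sum.mono_neutral_left) (use J J' IU in \<open>auto intro!: tns0\<close>)
    have "t + t' = (\<Sum>i\<in>J \<union> J'. tns i (f i + f' i))"
      unfolding t t' sum.distrib[symmetric] by (rule sum.cong) (use J J' IU in \<open>auto simp: bil(2)\<close>)
    then show ?thesis
      unfolding R_def using J(1,2,3,4) J'(1,2,3,4) B.subspace_add[OF V]
      by (intro exI[of _ "J \<union> J'"] exI[of _ "\<lambda>i. f i + f' i"]) simp
  qed
  have R_pure: "R (tns a b)" if ab: "a \<in> U" "b \<in> V" for a b
  proof -
    have "a \<in> A.span I" using ab I by simp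
    \<comment> \<open>Membership in \<open>U\<close> is carried through the induction because
      bilinearity of \<open>tns\<close> is known only on \<open>U\<close> and
      \<open>V\<close>.\<close>
    then have "a \<in> U \<and> R (tns a b)"
    proof (induction rule: A.span_induct_alt)
      case base
      have "tns 0 b = 0" using bil(3)[OF ab, of 0] by simp
      then show ?case using R0 A.subspace_0[OF U] by simp
    next
      case (step c i y)
      have i: "i \<in> U" and y: "y \<in> U" using step IU by auto
      have "R (tns i (sB c b))"
        unfolding R_def using ab(2) step(1) B.subspace_0[OF V] B.subspace_scale[OF V]
        by (intro exI[of _ "{i}"] exI[of _ "\<lambda>j. if j = i then sB c b else 0"]) auto
      then show ?case
        using R_add[of "tns i (sB c b)" "tns y b"] i y ab(2) step(2)
        by (simp add: bil A.subspace_scale[OF U] A.subspace_add[OF U])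
    qed
    then show ?thesis ..
  qed
  have R_scale: "R (sT c t)" if t: "R t" for c t
  proof -
    obtain J f where J: "finite J" "J \<subseteq> I" "\<And>i. f i \<in> V" "\<And>i. i \<notin> J \<Longrightarrow> f i = 0" "t = (\<Sum>i\<in>J. tns i (f i))"
      using t unfolding R_def by blast
    have "sT c t = (\<Sum>i\<in>J. tns i (sB c (f i)))"
      unfolding J(5) T.scale_sum_right by (rule sum.cong) (use J IU in \<open>auto simp: bil\<close>)
    then show ?thesis
      unfolding R_def using J(1,2,3,4) B.subspace_scale[OF V]
      by (intro exI[of _ J] exI[of _ "\<lambda>i. sB c (f i)"]) simp
  qed
  have "t \<in> T.span {tns a b | a b. a \<in> U \<and> b \<in> V}" using span_pure_tensors[OF T] by simp
  then have "R t"
  proof (induction rule: T.span_induct_alt)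
    case (step c x y)
    then obtain a b where "x = tns a b" "a \<in> U" "b \<in> V" by blast
    then show ?case using R_add[OF R_scale[OF R_pure]] step(2) by simp
  qed (rule R0)
  then show ?thesis using that unfolding R_def by blast
qed

text \<open>If \<open>y i \<noteq> 0\<close>, some functional \<open>g\<close> has
  \<open>g (y i) \<noteq> 0\<close>. The contraction sending \<open>a \<otimes> b\<close> to
  \<open>g b\<close> times \<open>a\<close> turns \<open>zero\<close> into a linear relation between
  the functions \<open>x j\<close>, valid at every \<open>p\<close>, with coefficients
  \<open>g (y j)\<close>; this contradicts \<open>indep\<close>.\<close>

lemma tensor_sum_eq_0D:
  assumes T: "is_tensor_product sA UNIV sB UNIV sT tns" and "finite I" "i \<in> I"
    and indep: "\<And>c. (\<And>p. (\<Sum>i\<in>I. sA (c i) (x i p)) = 0) \<Longrightarrow> c i = 0"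
    and zero: "\<And>p. (\<Sum>i\<in>I. tns (x i p) (y i)) = 0"
  shows "y i = 0"
proof (rule ccontr)
  interpret A: vector_space sA using T by (simp add: is_tensor_product_def)
  interpret B: vector_space sB using T by (simp add: is_tensor_product_def)
  interpret T: vector_space sT using T by (simp add: is_tensor_product_def)
  assume "y i \<noteq> 0"
  then obtain g where g: "Vector_Spaces.linear sB (*) g" "g (y i) \<noteq> 0"
    using B.separating_functional by blast
  interpret g: Vector_Spaces.linear sB "(*)" g by fact
  obtain h where h: "Vector_Spaces.linear sT sA h" "\<And>a b. h (tns a b) = sA (g b) a"
    by (rule tensor_lift_on[OF T A.vector_space_axioms, of "\<lambda>a b. sA (g b) a"])
       (auto simp: g.add g.scale A.scale_right_distrib A.scale_left_distrib mult.commute)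
  interpret h: Vector_Spaces.linear sT sA h by fact
  have "(\<Sum>i\<in>I. sA (g (y i)) (x i p)) = h (\<Sum>i\<in>I. tns (x i p) (y i))" for p
    by (simp add: h.sum h(2))
  then have "g (y i) = 0" using zero by (intro indep) simp
  then show False using g by simp
qed

section \<open>Endomorphisms of a tensor product and their identification with
  \<open>End(A) \<otimes> End(B)\<close>\<close>

text \<open>In coordinates of \<open>A\<close>, \<open>F\<close> is a finite matrix whose entries
  are endomorphisms of \<open>B\<close>. The tensor product enters through \<open>bil\<close>,
  \<open>ext\<close> and \<open>lift\<close>, so that the lemma can also be applied with the two
  factors exchanged.\<close>

lemma tensor_endomorphism_expansion:
  fixes sA :: "'k::field \<Rightarrow> 'a::ab_group_add \<Rightarrow> 'a" and sB :: "'k \<Rightarrow> 'b::ab_group_add \<Rightarrow> 'b"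
    and sT :: "'k \<Rightarrow> 't::ab_group_add \<Rightarrow> 't" and tns :: "'a \<Rightarrow> 'b \<Rightarrow> 't"
  assumes A: "vector_space sA" and B: "vector_space sB" and T: "vector_space sT" and fin: "finite_dim sA"
    and bil: "\<And>b. Vector_Spaces.linear sA sT (\<lambda>a. tns a b)" "\<And>a. Vector_Spaces.linear sB sT (tns a)"
    and ext: "\<And>g h. Vector_Spaces.linear sT sT g \<Longrightarrow> Vector_Spaces.linear sT sT h \<Longrightarrow>
      (\<And>a b. g (tns a b) = h (tns a b)) \<Longrightarrow> g = h"
    and lift: "\<And>f. (\<And>b. Vector_Spaces.linear sA sB (\<lambda>a. f a b)) \<Longrightarrow> (\<And>a. Vector_Spaces.linear sB sB (f a)) \<Longrightarrow>
      \<exists>g. Vector_Spaces.linear sT sB g \<and> (\<forall>a b. g (tns a b) = f a b)"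
    and F: "Vector_Spaces.linear sT sT F"
  obtains I :: "('a \<times> 'a) set" and \<phi> \<psi> where "finite I" "\<And>i. \<phi> i \<in> End sA" "\<And>i. \<psi> i \<in> End sB"
    "\<And>a b. F (tns a b) = (\<Sum>i\<in>I. tns (\<phi> i a) (\<psi> i b))"
proof -
  interpret A: vector_space sA by (rule A)
  interpret B: vector_space sB by (rule B)
  interpret T: vector_space sT by (rule T)
  interpret F: Vector_Spaces.linear sT sT F by (rule F)
  note L = linear_iff_vs[OF A A] linear_iff_vs[OF A B] linear_iff_vs[OF B B] linear_iff_vs[OF T T]
    linear_iff_vs[OF T B] linear_iff_vs[OF A vector_space_field]
  note bil' = bil(1)[unfolded linear_iff_vs[OF A T]] bil(2)[unfolded linear_iff_vs[OF B T]]
  obtain X where "finite X" "A.span X = UNIV"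
    using fin unfolding finite_dim_def by blast
  then obtain I c where I: "finite I" "\<And>i. Vector_Spaces.linear sA (*) (c i)" "\<And>v. v = (\<Sum>i\<in>I. sA (c i v) i)"
    using A.finite_coordinates by blast
  have c: "c i (x + y) = c i x + c i y" "c i (sA k x) = k * c i x" for i x y k
    using I(2)[of i] by (auto simp: L)
  \<comment> \<open>The contraction of a tensor by the coordinate functional \<open>c k\<close>; it
    reads off the \<open>B\<close>-valued coordinate at \<open>k\<close>.\<close>
  have "\<exists>p. Vector_Spaces.linear sT sB p \<and> (\<forall>a b. p (tns a b) = sB (c k a) b)" for k
    by (rule lift) (auto simp: L c B.scale_left_distrib B.scale_right_distrib mult.commute)
  then obtain p where p: "\<And>k. Vector_Spaces.linear sT sB (p k)" "\<And>k a b. p k (tns a b) = sB (c k a) b"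
    by metis
  have pl: "p k (x + y) = p k x + p k y" "p k (sT d x) = sB d (p k x)" for k x y d
    using p(1)[of k] by (auto simp: L)
  have sumA: "tns (\<Sum>i\<in>J. f i) b = (\<Sum>i\<in>J. tns (f i) b)" for J :: "'a set" and f b
  proof -
    interpret Vector_Spaces.linear sA sT "\<lambda>a. tns a b" by (rule bil(1))
    show ?thesis by (rule sum)
  qed
  have expand: "(\<Sum>k\<in>I. tns k (p k t)) = t" for t
  proof -
    have "(\<lambda>t. \<Sum>k\<in>I. tns k (p k t)) = (\<lambda>t. t)"
    proof (rule ext)
      show "Vector_Spaces.linear sT sT (\<lambda>t. \<Sum>k\<in>I. tns k (p k t))"
        by (simp add: L pl bil' sum.distrib T.scale_sum_right)
      show "(\<Sum>k\<in>I. tns k (p k (tns a b))) = tns a b" for a b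
      proof -
        have "(\<Sum>k\<in>I. tns k (p k (tns a b))) = tns (\<Sum>i\<in>I. sA (c i a) i) b"
          unfolding sumA by (simp add: p(2) bil')
        then show ?thesis using I(3)[of a] by simp
      qed
    qed (simp add: L)
    then show ?thesis by metis
  qed
  \<comment> \<open>The pair \<open>(j, k)\<close> carries the map sending \<open>a\<close> to
    \<open>c j a\<close> times \<open>k\<close>, together with the matrix entry sending
    \<open>b\<close> to the coordinate at \<open>k\<close> of \<open>F (tns j b)\<close>.\<close>
  show ?thesis
  proof (rule that[of "I \<times> I" "\<lambda>(j, k) a. sA (c j a) k" "\<lambda>(j, k) b. p k (F (tns j b))"])
    fix a b
    have "(\<Sum>i\<in>I \<times> I. tns ((case i of (j, k) \<Rightarrow> \<lambda>a. sA (c j a) k) a) ((case i of (j, k) \<Rightarrow> \<lambda>b. p k (F (tns j b))) b))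
      = (\<Sum>j\<in>I. \<Sum>k\<in>I. sT (c j a) (tns k (p k (F (tns j b)))))"
      unfolding sum.cartesian_product by (rule sum.cong) (auto simp: bil')
    also have "\<dots> = (\<Sum>j\<in>I. sT (c j a) (F (tns j b)))"
      unfolding T.scale_sum_right[symmetric] expand ..
    also have "\<dots> = F (tns (\<Sum>j\<in>I. sA (c j a) j) b)"
      by (simp add: sumA F.sum F.scale bil')
    also have "\<dots> = F (tns a b)"
      using I(3)[of a] by simp
    finally show "F (tns a b) = (\<Sum>i\<in>I \<times> I. tns ((case i of (j, k) \<Rightarrow> \<lambda>a. sA (c j a) k) a)
      ((case i of (j, k) \<Rightarrow> \<lambda>b. p k (F (tns j b))) b))" ..
  qed (use I(1) in \<open>auto simp: End_def L c pl bil' F.add F.scale A.scale_left_distrib\<close>)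
qed

lemma End_iff: "vector_space s \<Longrightarrow>
    \<phi> \<in> End s \<longleftrightarrow> (\<forall>x y. \<phi> (x + y) = \<phi> x + \<phi> y) \<and> (\<forall>c x. \<phi> (s c x) = s c (\<phi> x))"
  by (simp add: End_def linear_iff_vs)

lemma subspace_End:
  assumes "vector_space s"
  shows "module.subspace (fun_scale s) (End s)"
proof -
  interpret vector_space s by fact
  interpret F: vector_space "fun_scale s :: 'a \<Rightarrow> ('b \<Rightarrow> 'b) \<Rightarrow> _"
    by (rule vector_space_fun_scale[OF assms])
  show ?thesis
    by (auto simp: F.subspace_def End_iff[OF assms] fun_scale_def scale_right_distrib mult.commute)
qed

text \<open>\<open>\<Theta>\<close> comes from the universal property of
  \<open>End(A) \<otimes> End(B)\<close>. It is injective because a basis of \<open>End(A)\<close>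
  is independent as a family of functions, and surjective by the matrix expansion over the
  finite-dimensional factor.\<close>

lemma End_identification_ex:
  fixes sA :: "'k::field \<Rightarrow> 'a::ab_group_add \<Rightarrow> 'a" and sB :: "'k \<Rightarrow> 'b::ab_group_add \<Rightarrow> 'b"
    and sT :: "'k \<Rightarrow> 't::ab_group_add \<Rightarrow> 't"
  assumes T: "is_tensor_product sA UNIV sB UNIV sT tns"
    and E: "is_tensor_product (fun_scale sA) (End sA) (fun_scale sB) (End sB) sE tnsE"
    and fin: "finite_dim sA \<or> finite_dim sB"
  shows "\<exists>\<Theta>. is_End_identification sA sB sT tns sE tnsE \<Theta>"
proof -
  have vs: "vector_space sA" "vector_space sB" "vector_space sT" "vector_space sE"
    using T E by (auto simp: is_tensor_product_def)
  note vf = vector_space_fun_scale[OF vs(3), where 'x='t]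
  interpret A: vector_space sA by (rule vs)
  interpret T: vector_space sT by (rule vs)
  interpret E: vector_space sE by (rule vs)
  interpret FT: vector_space "fun_scale sT :: 'k \<Rightarrow> ('t \<Rightarrow> 't) \<Rightarrow> _" by (rule vf)
  interpret FA: vector_space "fun_scale sA :: 'k \<Rightarrow> ('a \<Rightarrow> 'a) \<Rightarrow> _" by (rule vector_space_fun_scale[OF vs(1)])
  note bil = tns_bilinear_on[OF T, simplified] and bilE = tns_bilinear_on[OF E]
  note EndA = End_iff[OF vs(1)] and EndB = End_iff[OF vs(2)]
  have "\<exists>g. Vector_Spaces.linear sT sT g \<and> (\<forall>a b. g (tns a b) = tns (\<phi> a) (\<psi> b))"
    if "\<phi> \<in> End sA" "\<psi> \<in> End sB" for \<phi> \<psi>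
    by (rule tensor_lift_on[OF T vs(3), of "\<lambda>a b. tns (\<phi> a) (\<psi> b)"]) (use that in \<open>auto simp: bil EndA EndB\<close>)
  then obtain M where M: "\<And>\<phi> \<psi>. \<phi> \<in> End sA \<Longrightarrow> \<psi> \<in> End sB \<Longrightarrow> Vector_Spaces.linear sT sT (M \<phi> \<psi>)"
    "\<And>\<phi> \<psi> a b. \<phi> \<in> End sA \<Longrightarrow> \<psi> \<in> End sB \<Longrightarrow> M \<phi> \<psi> (tns a b) = tns (\<phi> a) (\<psi> b)"
    by metis
  have M_End: "M \<phi> \<psi> \<in> End sT" if "\<phi> \<in> End sA" "\<psi> \<in> End sB" for \<phi> \<psi>
    using M(1)[OF that] by (simp add: End_def)
  have M_eq: "M \<phi> \<psi> = h" if "\<phi> \<in> End sA" "\<psi> \<in> End sB" "h \<in> End sT" "\<And>a b. tns (\<phi> a) (\<psi> b) = h (tns a b)"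
    for \<phi> \<psi> h
    by (rule tensor_ext[OF T M(1)]) (use that M(2) in \<open>auto simp: End_def\<close>)
  note subA = subspace_End[OF vs(1)] and subB = subspace_End[OF vs(2)] and subT = subspace_End[OF vs(3)]
  interpret FB: vector_space "fun_scale sB :: 'k \<Rightarrow> ('b \<Rightarrow> 'b) \<Rightarrow> _" by (rule vector_space_fun_scale[OF vs(2)])
  obtain \<Theta> where lin: "Vector_Spaces.linear sE (fun_scale sT) \<Theta>"
    and \<Theta>: "\<And>\<phi> \<psi>. \<phi> \<in> End sA \<Longrightarrow> \<psi> \<in> End sB \<Longrightarrow> \<Theta> (tnsE \<phi> \<psi>) = M \<phi> \<psi>"
    by (rule tensor_lift_on[OF E vf, of M])
       (auto intro!: M_eq M_End FA.subspace_add[OF subA] FB.subspace_add[OF subB] FT.subspace_add[OF subT]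
          FA.subspace_scale[OF subA, unfolded fun_scale_def] FB.subspace_scale[OF subB, unfolded fun_scale_def]
          FT.subspace_scale[OF subT, unfolded fun_scale_def]
          simp: M(2) bil fun_scale_def)
  interpret \<Theta>: Vector_Spaces.linear sE "fun_scale sT" \<Theta> by (rule lin)
  have in_End: "\<Theta> e \<in> End sT" for e
  proof -
    have "e \<in> E.span {tnsE a b | a b. a \<in> End sA \<and> b \<in> End sB}"
      using span_pure_tensors[OF E] by simp
    then show ?thesis
      proof (induction rule: E.span_induct_alt)
      case base
      show ?case
        unfolding \<Theta>.zero by (rule FT.subspace_0[OF subT])
    next
      case (step c x y)
      then obtain \<phi> \<psi> where "x = tnsE \<phi> \<psi>" "\<phi> \<in> End sA" "\<psi> \<in> End sB" by blast
      then show ?case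
        using FT.subspace_add[OF subT FT.subspace_scale[OF subT M_End] step(2)]
        by (simp only: \<Theta>.add \<Theta>.scale \<Theta>)
    qed
  qed
  have "e = 0" if e: "\<Theta> e = 0" for e
  proof -
    obtain I where I: "I \<subseteq> End sA" "FA.independent I" "End sA \<subseteq> FA.span I"
      using FA.maximal_independent_subset by blast
    then have spI: "FA.span I = End sA"
      using FA.span_minimal[OF I(1) subA] by blast
    obtain J f where J: "finite J" "J \<subseteq> I" "\<And>i. f i \<in> End sB" "e = (\<Sum>i\<in>J. tnsE i (f i))"
      using tensor_basis_expansion[OF E spI] by blast
    have JE: "i \<in> End sA" if "i \<in> J" for i
      using that J(2) I(1) by blast
    have "f i = 0" if i: "i \<in> J" for i
    proof
      fix b
      \<comment> \<open>For fixed \<open>b\<close>, the basis elements themselves serve as the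
        independent functions and the values \<open>f i b\<close> as the right factors.\<close>
      have "f i b = 0"
      proof (rule tensor_sum_eq_0D[OF T J(1) i, of "\<lambda>i p. i p" "\<lambda>i. f i b"])
        fix c assume "\<And>p. (\<Sum>i\<in>J. sA (c i) (i p)) = 0"
        then have "(\<Sum>i\<in>J. fun_scale sA (c i) i) = 0"
          by (auto simp: sum_fun_apply fun_scale_def)
        then show "c i = 0"
          using I(2) J(1,2) i unfolding FA.independent_explicit_finite_subsets by blast
      next
        fix p
        have "(\<Sum>i\<in>J. tns (i p) (f i b)) = (\<Sum>i\<in>J. \<Theta> (tnsE i (f i)) (tns p b))"
          by (rule sum.cong) (auto simp: \<Theta> M(2) JE J(3))
        also have "\<dots> = \<Theta> e (tns p b)"
          by (simp add: J(4) \<Theta>.sum sum_fun_apply)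
        finally show "(\<Sum>i\<in>J. tns (i p) (f i b)) = 0"
          using e by simp
      qed
      then show "f i b = 0 b" by simp
    qed
    moreover have "tnsE i 0 = 0" if "i \<in> J" for i
      using bilE(4)[OF JE[OF that] FB.subspace_0[OF subB], of 0] by simp
    ultimately show ?thesis
      by (simp add: J(4))
  qed
  then have inj: "inj \<Theta>"
    by (simp add: \<Theta>.inj_iff_eq_0)
  have surj: "F \<in> range \<Theta>" if F: "F \<in> End sT" for F
  proof -
    have lF: "Vector_Spaces.linear sT sT F"
      using F by (simp add: End_def)
    \<comment> \<open>The index type stays general: expansions are indexed by pairs from
      \<open>'a\<close> or from \<open>'b\<close>, according to which factor is
      finite-dimensional.\<close>
    have imp: "F \<in> range \<Theta>"
      if I: "finite I" "\<And>i. \<phi> i \<in> End sA" "\<And>i. \<psi> i \<in> End sB" "\<And>a b. F (tns a b) = (\<Sum>i\<in>I. tns (\<phi> i a) (\<psi> i b))"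
      for I and \<phi> :: "'x \<Rightarrow> 'a \<Rightarrow> 'a" and \<psi>
    proof -
      have "F = \<Theta> (\<Sum>i\<in>I. tnsE (\<phi> i) (\<psi> i))"
      proof (rule tensor_ext[OF T lF])
        show "Vector_Spaces.linear sT sT (\<Theta> (\<Sum>i\<in>I. tnsE (\<phi> i) (\<psi> i)))"
          using in_End by (simp add: End_def)
        show "F (tns a b) = \<Theta> (\<Sum>i\<in>I. tnsE (\<phi> i) (\<psi> i)) (tns a b)" for a b
          by (simp add: \<Theta>.sum sum_fun_apply \<Theta> M(2) I(2,3) I(4))
      qed
      then show ?thesis by blast
    qed
    note bl = tns_bilinear[OF T]
    from fin show ?thesis
    proof
      assume fA: "finite_dim sA"
      show ?thesis
      proof (rule tensor_endomorphism_expansion[OF vs(1,2,3) fA bl _ _ lF])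
        show "g = h" if "Vector_Spaces.linear sT sT g" "Vector_Spaces.linear sT sT h"
          "\<And>a b. g (tns a b) = h (tns a b)" for g h
          by (rule tensor_ext[OF T that])
        show "\<exists>g. Vector_Spaces.linear sT sB g \<and> (\<forall>a b. g (tns a b) = f a b)"
          if "\<And>b. Vector_Spaces.linear sA sB (\<lambda>a. f a b)" "\<And>a. Vector_Spaces.linear sB sB (f a)" for f
          by (rule tensor_lift_ex[OF T vs(2) that])
      qed (rule imp)
    next
      assume fB: "finite_dim sB"
      show ?thesis
      \<comment> \<open>The expansion is applied to the flipped pairing, which sends
        \<open>b\<close> and \<open>a\<close> to \<open>tns a b\<close>.\<close>
      proof (rule tensor_endomorphism_expansion[OF vs(2,1,3) fB bl(2,1) _ _ lF])
        show "g = h" if "Vector_Spaces.linear sT sT g" "Vector_Spaces.linear sT sT h"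
          "\<And>b a. g (tns a b) = h (tns a b)" for g h
          by (rule tensor_ext[OF T that])
        show "\<exists>g. Vector_Spaces.linear sT sA g \<and> (\<forall>b a. g (tns a b) = f b a)"
          if "\<And>a. Vector_Spaces.linear sB sA (\<lambda>b. f b a)" "\<And>b. Vector_Spaces.linear sA sA (f b)" for f
          using tensor_lift_ex[OF T vs(1), of "\<lambda>a b. f b a"] that by blast
        show "F \<in> range \<Theta>" if "finite I" "\<And>i. \<phi> i \<in> End sB" "\<And>i. \<psi> i \<in> End sA"
          "\<And>b a. F (tns a b) = (\<Sum>i\<in>I. tns (\<psi> i a) (\<phi> i b))" for I :: "('b \<times> 'b) set" and \<phi> \<psi>
          by (rule imp[OF that(1,3,2,4)])
      qed
    qed
  qed
  have "bij_betw \<Theta> UNIV (End sT)"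
    unfolding bij_betw_def using inj in_End surj by blast
  then show ?thesis
    unfolding is_End_identification_def using lin \<Theta> M(2) by auto
qed

section \<open>Bilinearity of the product and its symmetry under exchange of the factors\<close>

section \<open>Products of algebras over quadratic operads\<close>

lemma algebra_product_bilinear:
  assumes V: "vector_space s" and f: "\<alpha> {0, 1} \<mu> \<in> piece (End_operad s) {0, 1}"
  shows "Vector_Spaces.linear s s (algebra_product \<alpha> \<mu> a)"
    and "Vector_Spaces.linear s s (\<lambda>a. algebra_product \<alpha> \<mu> a b)"
proof -
  \<comment> \<open>Both forms are updates of a constant assignment, the shape in which
    multilinearity is available. The second form alters the inputs from \<open>2\<close> on, which
    the operation ignores.\<close>
  have l: "algebra_product \<alpha> \<mu> a b = \<alpha> {0, 1} \<mu> ((\<lambda>_. b)(0 := a))" for a b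
    unfolding algebra_product_def by (rule arg_cong[of _ _ "\<alpha> {0, 1} \<mu>"]) auto
  have r: "algebra_product \<alpha> \<mu> a b = \<alpha> {0, 1} \<mu> ((\<lambda>_. a)(1 := b))" for a b
    unfolding algebra_product_def by (rule End_dep[OF f]) auto
  show "Vector_Spaces.linear s s (algebra_product \<alpha> \<mu> a)"
    unfolding linear_iff_vs[OF V V] r using End_lin[OF f _ V, of 1] by blast
  show "Vector_Spaces.linear s s (\<lambda>a. algebra_product \<alpha> \<mu> a b)"
    unfolding linear_iff_vs[OF V V] l using End_lin[OF f _ V, of 0] by blast
qed

text \<open>The ideal generator \<open>xy - \<epsilon> yx\<close> is killed by \<open>\<pi>\<close>,
  so \<open>\<mu>\<close> equals \<open>\<epsilon>\<close> times itself with the inputs exchanged;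
  \<open>\<alpha>\<close> carries this relation over to the algebra.\<close>

lemma quadratic_operad_algebra:
  assumes P: "quadratic_operad P \<mu> \<epsilon> R" and A: "operad_algebra P s \<alpha>"
  shows "Vector_Spaces.linear s s (algebra_product \<alpha> \<mu> a)"
    and "Vector_Spaces.linear s s (\<lambda>a. algebra_product \<alpha> \<mu> a b)"
    and "algebra_product \<alpha> \<mu> a b = s \<epsilon> (algebra_product \<alpha> \<mu> b a)"
proof -
  have V: "vector_space s" and \<alpha>: "operad_morphism P (End_operad s) \<alpha>"
    using A by (auto simp: operad_algebra_def)
  obtain \<pi> where \<pi>: "operad_morphism magmatic_operad P \<pi>"
    and \<mu>: "\<pi> {0, 1} (monom (Mult (Var 0) (Var 1))) = \<mu>"
    and ker: "\<And>S. finite S \<Longrightarrow> {p \<in> piece magmatic_operad S. \<pi> S p = 0} =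
        {p. operad_ideal magmatic_operad (quadratic_relations \<epsilon> R) S p}"
    using P unfolding quadratic_operad_def by auto
  interpret \<pi>: operad_morphism magmatic_operad P \<pi> by (rule \<pi>)
  interpret \<alpha>: operad_morphism P "End_operad s" \<alpha> by (rule \<alpha>)
  interpret F: vector_space "free_scale :: 'a \<Rightarrow> (monomial \<Rightarrow>\<^sub>0 'a) \<Rightarrow> _"
    by (rule vector_space_free_scale)
  let ?xy = "monom (Mult (Var 0) (Var 1)) :: monomial \<Rightarrow>\<^sub>0 'a"
  let ?yx = "monom (Mult (Var 1) (Var 0)) :: monomial \<Rightarrow>\<^sub>0 'a"
  \<comment> \<open>Truncated subtraction exchanges \<open>0\<close> and \<open>1\<close>;
    relabelling depends only on these two values.\<close>
  let ?sw = "\<lambda>i::nat. 1 - i"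
  have sub: "F.subspace (piece magmatic_operad {0, 1})"
    using \<pi>.P.subspace_piece[of "{0, 1}"] by simp
  have xy: "?xy \<in> piece magmatic_operad {0, 1}" and yx: "?yx \<in> piece magmatic_operad {0, 1}"
    by (auto simp: piece_magmatic)
  have m: "\<mu> \<in> piece P {0, 1}"
    using \<pi>.morphism_piece[OF _ xy] \<mu> by simp
  then have f: "\<alpha> {0, 1} \<mu> \<in> piece (End_operad s) {0, 1}"
    using \<alpha>.morphism_piece by simp
  have sw: "inj_on ?sw {0, 1}" "?sw ` {0, 1} = {0, 1}"
    by (auto simp: inj_on_def)
  have "\<pi> {0, 1} ?yx = relabel P {0, 1} ?sw \<mu>"
    using \<pi>.morphism_relabel[OF _ sw(1) xy] \<mu> by (simp add: insert_commute)
  moreover have "\<pi> {0, 1} ?xy = scale P \<epsilon> (\<pi> {0, 1} ?yx)"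
  proof -
    have lin: "linear_on (piece magmatic_operad {0, 1}) free_scale (scale P) (\<pi> {0, 1})"
      using \<pi>.morphism_linear[of "{0, 1}"] by simp
    have "operad_ideal magmatic_operad (quadratic_relations \<epsilon> R) {0, 1} (?xy - free_scale \<epsilon> ?yx)"
      using F.subspace_diff[OF sub xy F.subspace_scale[OF sub yx]]
      by (intro ideal_gen) (simp_all add: quadratic_relations_def Let_def)
    then have 0: "\<pi> {0, 1} (?xy - free_scale \<epsilon> ?yx) = 0"
      using ker[of "{0, 1}"] by auto
    have "\<pi> {0, 1} ?xy = \<pi> {0, 1} (?xy - free_scale \<epsilon> ?yx + free_scale \<epsilon> ?yx)"
      by simp
    also have "\<dots> = \<pi> {0, 1} (?xy - free_scale \<epsilon> ?yx) + \<pi> {0, 1} (free_scale \<epsilon> ?yx)"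
      using lin F.subspace_diff[OF sub xy F.subspace_scale[OF sub yx]] F.subspace_scale[OF sub yx]
      unfolding linear_on_def by blast
    also have "\<dots> = scale P \<epsilon> (\<pi> {0, 1} ?yx)"
      unfolding 0 using lin yx by (simp add: linear_on_def)
    finally show ?thesis .
  qed
  ultimately have \<mu>_sw: "\<mu> = scale P \<epsilon> (relabel P {0, 1} ?sw \<mu>)"
    using \<mu> by simp
  have m': "relabel P {0, 1} ?sw \<mu> \<in> piece P {0, 1}"
    using \<pi>.Q.relabel_piece[OF _ sw(1) m] sw(2) by simp
  have "\<alpha> {0, 1} \<mu> = fun_scale s \<epsilon> (\<alpha> {0, 1} (relabel P {0, 1} ?sw \<mu>))"
    using \<alpha>.morphism_linear[of "{0, 1}"] m' by (subst \<mu>_sw) (simp add: linear_on_def)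
  also have "\<alpha> {0, 1} (relabel P {0, 1} ?sw \<mu>) = (\<lambda>x. \<alpha> {0, 1} \<mu> (\<lambda>i. x (?sw i)))"
    using \<alpha>.morphism_relabel[OF _ sw(1) m] sw(2) by simp
  finally have "\<alpha> {0, 1} \<mu> x = s \<epsilon> (\<alpha> {0, 1} \<mu> (\<lambda>i. x (?sw i)))" for x
    by (metis fun_scale_def)
  then have "algebra_product \<alpha> \<mu> a b = s \<epsilon> (\<alpha> {0, 1} \<mu> (\<lambda>i. if ?sw i = 0 then a else b))"
    unfolding algebra_product_def .
  also have "\<alpha> {0, 1} \<mu> (\<lambda>i. if ?sw i = 0 then a else b) = algebra_product \<alpha> \<mu> b a"
    unfolding algebra_product_def by (rule End_dep[OF f]) auto
  finally show "algebra_product \<alpha> \<mu> a b = s \<epsilon> (algebra_product \<alpha> \<mu> b a)" .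
  show "Vector_Spaces.linear s s (algebra_product \<alpha> \<mu> a)"
    "Vector_Spaces.linear s s (\<lambda>a. algebra_product \<alpha> \<mu> a b)"
    by (rule algebra_product_bilinear[of s \<alpha> \<mu>, OF V f])+
qed

section \<open>Defects and their kernels\<close>

section \<open>The Hom-Lie structures\<close>

text \<open>For a bilinear product both defects are linear in the endomorphism. The triple is a
  single argument, so that each endomorphism yields one function, as needed for
  \<open>tensor_sum_eq_0D\<close>.\<close>

definition lie_defect :: "('c \<Rightarrow> 'c \<Rightarrow> 'c::ab_group_add) \<Rightarrow> ('c \<Rightarrow> 'c) \<Rightarrow> 'c \<times> 'c \<times> 'c \<Rightarrow> 'c" where
  "lie_defect m \<phi> = (\<lambda>(a, b, c). m (m a b) (\<phi> c) + m (m c a) (\<phi> b) + m (m b c) (\<phi> a))"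

definition cycl_defect :: "('c \<Rightarrow> 'c \<Rightarrow> 'c::ab_group_add) \<Rightarrow> ('c \<Rightarrow> 'c) \<Rightarrow> 'c \<times> 'c \<times> 'c \<Rightarrow> 'c" where
  "cycl_defect m \<phi> = (\<lambda>(a, b, c). m (m a b) (\<phi> c) - m (m c a) (\<phi> b))"

lemma HomLie_eq: "HomLie s m = {\<phi> \<in> End s. \<forall>p. lie_defect m \<phi> p = 0}"
  by (auto simp: HomLie_def lie_defect_def)

lemma HomCycl_eq: "HomCycl s m = {\<phi> \<in> End s. \<forall>p. cycl_defect m \<phi> p = 0}"
  by (auto simp: HomCycl_def cycl_defect_def)

lemma HomLie_iff: "\<phi> \<in> HomLie s m \<longleftrightarrow> \<phi> \<in> End s \<and> (\<forall>p. lie_defect m \<phi> p = 0)"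
  unfolding HomLie_eq by blast

lemma HomCycl_iff: "\<phi> \<in> HomCycl s m \<longleftrightarrow> \<phi> \<in> End s \<and> (\<forall>p. cycl_defect m \<phi> p = 0)"
  unfolding HomCycl_eq by blast

lemma subspace_defect_kernel:
  assumes V: "vector_space s"
    and add: "\<And>\<phi> \<psi> p. D (\<phi> + \<psi>) p = D \<phi> p + D \<psi> p" and scale: "\<And>c \<phi> p. D (fun_scale s c \<phi>) p = s c (D \<phi> p)"
  shows "module.subspace (fun_scale s) {\<phi> \<in> End s. \<forall>p. D \<phi> p = 0}"
proof -
  interpret vector_space s by fact
  interpret F: vector_space "fun_scale s :: 'a \<Rightarrow> ('b \<Rightarrow> 'b) \<Rightarrow> _"
    by (rule vector_space_fun_scale[OF V])
  note sub = subspace_End[OF V]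
  have "D 0 p = 0" for p
    using scale[of 0 0 p] by simp
  then show ?thesis
    unfolding F.subspace_def
    using F.subspace_0[OF sub] F.subspace_add[OF sub] F.subspace_scale[OF sub] by (simp add: add scale)
qed

text \<open>On the intersection the three terms of the cyclic sum coincide, so three times each of
  them is zero.\<close>

lemma HomLie_Int_HomCycl:
  fixes s :: "'k::field \<Rightarrow> 'c::ab_group_add \<Rightarrow> 'c"
  assumes V: "vector_space s" and three: "(3 :: 'k) \<noteq> 0"
  shows "HomLie s m \<inter> HomCycl s m \<subseteq> Hom2Nilp s m"
proof
  interpret vector_space s by fact
  fix \<phi> assume \<phi>: "\<phi> \<in> HomLie s m \<inter> HomCycl s m"
  have "m (m a b) (\<phi> c) = 0" for a b c
  proof -
    let ?x = "m (m a b) (\<phi> c)"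
    have cycl: "m (m a b) (\<phi> c) = m (m c a) (\<phi> b)" for a b c
      using \<phi> by (simp add: HomCycl_def)
    have "m (m a b) (\<phi> c) + m (m c a) (\<phi> b) + m (m b c) (\<phi> a) = 0"
      using \<phi> by (simp add: HomLie_def)
    then have "?x + ?x + ?x = 0"
      using cycl[of a b c] cycl[of c a b] by simp
    moreover have "s 3 ?x = ?x + ?x + ?x"
      using scale_left_distrib[of "1 + 1" 1 ?x] scale_left_distrib[of 1 1 ?x] by (simp add: numeral_3_eq_3)
    ultimately show ?thesis
      using three by (metis scale_eq_0_iff)
  qed
  then show "\<phi> \<in> Hom2Nilp s m"
    using \<phi> by (simp add: Hom2Nilp_def HomLie_def)
qed

section \<open>Hom-Lie structures for a bracket that is twice the product on pure tensors\<close>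

text \<open>Anticommutativity of \<open>B\<close> is present only in the form \<open>br_tns\<close>.
  That form also holds when the product of \<open>A\<close> is zero, so both signs occurring in the
  final proof fit the locale.\<close>

locale doubled_tensor_bracket =
  fixes sA :: "'k::field \<Rightarrow> 'a::ab_group_add \<Rightarrow> 'a" and sB :: "'k \<Rightarrow> 'b::ab_group_add \<Rightarrow> 'b"
    and sT :: "'k \<Rightarrow> 't::ab_group_add \<Rightarrow> 't" and tns :: "'a \<Rightarrow> 'b \<Rightarrow> 't"
    and sE :: "'k \<Rightarrow> 'e::ab_group_add \<Rightarrow> 'e" and tnsE :: "('a \<Rightarrow> 'a) \<Rightarrow> ('b \<Rightarrow> 'b) \<Rightarrow> 'e"
    and mA :: "'a \<Rightarrow> 'a \<Rightarrow> 'a" and mB :: "'b \<Rightarrow> 'b \<Rightarrow> 'b" and br :: "'t \<Rightarrow> 't \<Rightarrow> 't"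
    and \<Theta> :: "'e \<Rightarrow> 't \<Rightarrow> 't"
  assumes two: "(2 :: 'k) \<noteq> 0" and three: "(3 :: 'k) \<noteq> 0"
    and T: "is_tensor_product sA UNIV sB UNIV sT tns"
    and E: "is_tensor_product (fun_scale sA) (End sA) (fun_scale sB) (End sB) sE tnsE"
    and identification: "is_End_identification sA sB sT tns sE tnsE \<Theta>"
    and mA_linear: "\<And>x. Vector_Spaces.linear sA sA (mA x)" "\<And>y. Vector_Spaces.linear sA sA (\<lambda>x. mA x y)"
    and mB_linear: "\<And>x. Vector_Spaces.linear sB sB (mB x)" "\<And>y. Vector_Spaces.linear sB sB (\<lambda>x. mB x y)"
    and mA_commute: "\<And>a b. mA a b = mA b a"
    and br_linear: "\<And>x. Vector_Spaces.linear sT sT (br x)" "\<And>y. Vector_Spaces.linear sT sT (\<lambda>x. br x y)"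
    and br_tns: "\<And>a b a' b'. br (tns a b) (tns a' b') = sT 2 (tns (mA a a') (mB b b'))"
begin

sublocale A: vector_space sA using T by (simp add: is_tensor_product_def)
sublocale B: vector_space sB using T by (simp add: is_tensor_product_def)
sublocale T: vector_space sT using T by (simp add: is_tensor_product_def)
sublocale E: vector_space sE using E by (simp add: is_tensor_product_def)
sublocale FA: vector_space "fun_scale sA :: 'k \<Rightarrow> ('a \<Rightarrow> 'a) \<Rightarrow> _"
  by (rule vector_space_fun_scale[OF A.vector_space_axioms])
sublocale \<Theta>: Vector_Spaces.linear sE "fun_scale sT" \<Theta>
  using identification by (simp add: is_End_identification_def)

lemmas tns_simps = tns_bilinear_on[OF T, simplified]
lemmas mA_simps = mA_linear[unfolded linear_iff_vs[OF A.vector_space_axioms A.vector_space_axioms]]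
lemmas mB_simps = mB_linear[unfolded linear_iff_vs[OF B.vector_space_axioms B.vector_space_axioms]]
lemmas br_simps = br_linear[unfolded linear_iff_vs[OF T.vector_space_axioms T.vector_space_axioms]]

lemma Theta_End: "\<Theta> e \<in> End sT"
  using identification by (auto simp: is_End_identification_def bij_betw_def)

lemma Theta_tnsE: "\<phi> \<in> End sA \<Longrightarrow> \<psi> \<in> End sB \<Longrightarrow> \<Theta> (tnsE \<phi> \<psi>) (tns a b) = tns (\<phi> a) (\<psi> b)"
  using identification by (simp add: is_End_identification_def)

lemma tensor_eq_0I:
  assumes "\<And>x y. g (x + y) = g x + g y" "\<And>c x. g (sT c x) = sT c (g x)" "\<And>a b. g (tns a b) = 0"
  shows "g t = 0"
proof -
  have "g = (\<lambda>_. 0)"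
    by (rule tensor_ext[OF T, of sT])
       (auto simp: assms linear_iff_vs[OF T.vector_space_axioms T.vector_space_axioms])
  then show ?thesis by simp
qed

text \<open>The Hom-Lie expression of \<open>\<phi> \<otimes> \<psi>\<close> at
  \<open>a \<otimes> a'\<close>, \<open>b \<otimes> b'\<close>, \<open>c \<otimes> c'\<close>, up to
  the factor \<open>4\<close>. The triples are separate arguments so that one can be permuted while
  the other stays fixed.\<close>

definition cyclic_sum where
  "cyclic_sum \<phi> \<psi> = (\<lambda>(a, b, c) (a', b', c'). tns (mA (mA a b) (\<phi> c)) (mB (mB a' b') (\<psi> c'))
    + tns (mA (mA c a) (\<phi> b)) (mB (mB c' a') (\<psi> b')) + tns (mA (mA b c) (\<phi> a)) (mB (mB b' c') (\<psi> a')))"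

text \<open>The Hom-Lie expression is trilinear, so pure tensors suffice; there the two nested
  brackets contribute the factor \<open>4\<close>, which is invertible.\<close>

lemma HomLie_tensor_iff:
  assumes F: "F \<in> End sT" and F_tns: "\<And>a b. F (tns a b) = (\<Sum>i\<in>J. tns (\<phi> i a) (\<psi> i b))"
  shows "F \<in> HomLie sT br \<longleftrightarrow> (\<forall>p q. (\<Sum>i\<in>J. cyclic_sum (\<phi> i) (\<psi> i) p q) = 0)"
proof -
  have F_lin: "F (x + y) = F x + F y" "F (sT c x) = sT c (F x)" for x y c
    using F by (auto simp: End_iff[OF T.vector_space_axioms])
  have br_sum: "br x (sum f J) = (\<Sum>i\<in>J. br x (f i))" for x and f :: "'c \<Rightarrow> 't"
  proof -
    interpret Vector_Spaces.linear sT sT "br x" by (rule br_linear)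
    show ?thesis by (rule sum)
  qed
  define G where "G x y z = br (br x y) (F z) + br (br z x) (F y) + br (br y z) (F x)" for x y z
  have br3: "br (br (tns a a') (tns b b')) (F (tns c c')) =
    sT 4 (\<Sum>i\<in>J. tns (mA (mA a b) (\<phi> i c)) (mB (mB a' b') (\<psi> i c')))" for a b c a' b' c'
    by (simp add: F_tns br_tns br_simps br_sum T.scale_sum_right)
  have G_tns: "G (tns a a') (tns b b') (tns c c') = sT 4 (\<Sum>i\<in>J. cyclic_sum (\<phi> i) (\<psi> i) (a, b, c) (a', b', c'))"
    for a b c a' b' c'
    by (simp add: G_def br3 cyclic_sum_def sum.distrib T.scale_right_distrib)
  have four: "(4 :: 'k) \<noteq> 0"
    using two by (metis mult_2_right mult_eq_0_iff numeral_Bit0)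
  have "(\<forall>x y z. G x y z = 0) \<longleftrightarrow> (\<forall>a a' b b' c c'. G (tns a a') (tns b b') (tns c c') = 0)"
  proof (intro iffI allI)
    fix x y z assume *: "\<forall>a a' b b' c c'. G (tns a a') (tns b b') (tns c c') = 0"
    \<comment> \<open>Pure tensors are replaced by arbitrary ones in one argument at a time,
      starting with the last.\<close>
    have z: "G (tns a a') (tns b b') z = 0" for a a' b b' z
      by (rule tensor_eq_0I) (use * in \<open>auto simp: G_def F_lin br_simps algebra_simps T.scale_right_distrib\<close>)
    have y: "G (tns a a') y z = 0" for a a' y z
      by (rule tensor_eq_0I[of "\<lambda>y. G (tns a a') y z"])
         (simp_all add: z, simp_all add: G_def F_lin br_simps algebra_simps T.scale_right_distrib)
    show "G x y z = 0"
      by (rule tensor_eq_0I[of "\<lambda>x. G x y z"])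
         (simp_all add: y, simp_all add: G_def F_lin br_simps algebra_simps T.scale_right_distrib)
  qed blast
  moreover have "F \<in> HomLie sT br \<longleftrightarrow> (\<forall>x y z. G x y z = 0)"
    using F by (simp add: HomLie_def G_def)
  ultimately show ?thesis
    using four by (auto simp: G_tns)
qed

text \<open>The tensor of the two defects has nine terms; each rotation of \<open>(a, b, c)\<close>
  against the fixed \<open>q\<close> accounts for three.\<close>

lemma lie_defect_tensor:
  "tns (lie_defect mA \<phi> (a, b, c)) (lie_defect mB \<psi> q) =
    cyclic_sum \<phi> \<psi> (a, b, c) q + cyclic_sum \<phi> \<psi> (b, c, a) q + cyclic_sum \<phi> \<psi> (c, a, b) q"
  by (cases q) (simp add: lie_defect_def cyclic_sum_def tns_simps add_ac)

text \<open>By commutativity, exchanging \<open>b\<close> and \<open>c\<close> exchanges the first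
  two left factors of \<open>cyclic_sum\<close> and fixes the third. In the difference the third
  terms cancel and the other four form a tensor of two differences.\<close>

lemma cycl_defect_tensor:
  "tns (cycl_defect mA \<phi> (a, b, c)) (cycl_defect mB \<psi> q) =
    cyclic_sum \<phi> \<psi> (a, b, c) q - cyclic_sum \<phi> \<psi> (a, c, b) q"
proof -
  have diff: "tns (x - x') (y - y') = tns x y - tns x y' - (tns x' y - tns x' y')" for x x' y y'
  proof -
    interpret l: Vector_Spaces.linear sA sT "\<lambda>a. tns a z" for z by (rule tns_bilinear[OF T])
    interpret r: Vector_Spaces.linear sB sT "tns z" for z by (rule tns_bilinear[OF T])
    show ?thesis by (simp add: l.diff r.diff)
  qed
  show ?thesis
    by (cases q) (simp add: cycl_defect_def cyclic_sum_def diff mA_commute[of c b] mA_commute[of c a] mA_commute[of b a])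
qed

text \<open>Terms outside \<open>C\<close> drop out of the sum. On the span of \<open>C\<close> the
  map \<open>D\<close> is injective, so the functions \<open>D j\<close> for \<open>j\<close> in
  \<open>J \<inter> C\<close> are linearly independent and \<open>tensor_sum_eq_0D\<close>
  applies.\<close>

lemma tensor_defect_eq_0D:
  assumes add: "\<And>\<phi> \<chi> p. D (\<phi> + \<chi>) p = D \<phi> p + D \<chi> p" and scale: "\<And>c \<phi> p. D (fun_scale sA c \<phi>) p = sA c (D \<phi> p)"
    and J: "finite J" "FA.independent C" and i: "i \<in> J" "i \<in> C"
    and outside: "\<And>j p. j \<in> J \<Longrightarrow> j \<notin> C \<Longrightarrow> D j p = 0"
    and inj: "\<And>\<phi>. \<phi> \<in> FA.span C \<Longrightarrow> (\<And>p. D \<phi> p = 0) \<Longrightarrow> \<phi> = 0"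
    and zero: "\<And>p. (\<Sum>j\<in>J. tns (D j p) (y j)) = 0"
  shows "y i = 0"
proof (rule tensor_sum_eq_0D[OF T, of "J \<inter> C" i D y])
  have tns0: "tns 0 b = 0" for b
    using tns_simps(3)[of 0 0 b] by simp
  show "(\<Sum>j\<in>J \<inter> C. tns (D j p) (y j)) = 0" for p
    unfolding zero[of p, symmetric] by (rule sum.mono_neutral_left) (auto simp: J outside tns0)
  fix c assume c: "\<And>p. (\<Sum>j\<in>J \<inter> C. sA (c j) (D j p)) = 0"
  have D0: "D 0 p = 0" for p
    using scale[of 0 0 p] by simp
  have "D (\<Sum>j\<in>X. fun_scale sA (c j) j) p = (\<Sum>j\<in>X. sA (c j) (D j p))" for X p
    by (induction X rule: infinite_finite_induct) (simp_all add: D0 add scale del: plus_fun_apply zero_fun_apply)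
  then have "(\<Sum>j\<in>J \<inter> C. fun_scale sA (c j) j) = 0"
    using c by (intro inj FA.span_sum FA.span_scale FA.span_base) simp_all
  then show "c i = 0"
    using J(2)[unfolded FA.independent_explicit_finite_subsets, rule_format, of "J \<inter> C" c i] J(1) i by simp
qed (use J i in auto)

lemma HomLie_tensor:
  "\<Theta> e \<in> HomLie sT br \<longleftrightarrow> e \<in> subspace_tensor sE tnsE (HomLie sA mA) (HomCycl sB mB)
        + subspace_tensor sE tnsE (Hom2Nilp sA mA) (End sB)
        + subspace_tensor sE tnsE (HomCycl sA mA) (HomLie sB mB)
        + subspace_tensor sE tnsE (End sA) (Hom2Nilp sB mB)"
proof -
  \<comment> \<open>A sum of spans is the span of the union, so the right-hand side becomes a single
    span of pure tensors.\<close>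
  define pure where "pure U V = {tnsE \<phi> \<psi> | \<phi> \<psi>. \<phi> \<in> U \<and> \<psi> \<in> V}" for U V
  let ?X = "pure (HomLie sA mA) (HomCycl sB mB) \<union> pure (Hom2Nilp sA mA) (End sB)
    \<union> pure (HomCycl sA mA) (HomLie sB mB) \<union> pure (End sA) (Hom2Nilp sB mB)"
  have plus: "E.span U + E.span V = E.span (U \<union> V)" for U V
    unfolding E.span_Un set_plus_def by blast
  have subsets: "HomLie s m \<subseteq> End s" "HomCycl s m \<subseteq> End s" "Hom2Nilp s m \<subseteq> End s" for s m
    by (auto simp: HomLie_def HomCycl_def Hom2Nilp_def)
  have tns0: "tns 0 b = 0" "tns a 0 = 0" for a b
    using tns_simps(3)[of 0 0 b] tns_simps(4)[of a 0 0] by simp_all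
  have "\<Theta> e \<in> HomLie sT br \<longleftrightarrow> e \<in> E.span ?X"
  proof
    assume e: "e \<in> E.span ?X"
    have sub: "E.subspace {e. \<Theta> e \<in> HomLie sT br}"
    proof -
      have "\<Theta>.vs2.subspace (HomLie sT br)"
        unfolding HomLie_eq by (rule subspace_defect_kernel[OF T.vector_space_axioms])
          (auto simp: lie_defect_def fun_scale_def br_simps T.scale_right_distrib)
      then show ?thesis
        using \<Theta>.subspace_vimage[of "HomLie sT br"] by (simp add: vimage_def)
    qed
    have pure_subset: "pure U V \<subseteq> {e. \<Theta> e \<in> HomLie sT br}"
      if "U \<subseteq> End sA" "V \<subseteq> End sB" "\<And>\<phi> \<psi> p q. \<phi> \<in> U \<Longrightarrow> \<psi> \<in> V \<Longrightarrow> cyclic_sum \<phi> \<psi> p q = 0" for U V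
    proof -
      have "\<Theta> (tnsE \<phi> \<psi>) \<in> HomLie sT br" if "\<phi> \<in> U" "\<psi> \<in> V" for \<phi> \<psi>
      proof (rule HomLie_tensor_iff[OF Theta_End, THEN iffD2])
        \<comment> \<open>A pure tensor is an expansion with one term, indexed by
          \<open>()\<close>.\<close>
        show "\<Theta> (tnsE \<phi> \<psi>) (tns a b) = (\<Sum>_\<in>{()}. tns (\<phi> a) (\<psi> b))" for a b
          using that \<open>U \<subseteq> End sA\<close> \<open>V \<subseteq> End sB\<close> by (auto intro!: Theta_tnsE)
      qed (simp add: that \<open>\<And>\<phi> \<psi> p q. \<phi> \<in> U \<Longrightarrow> \<psi> \<in> V \<Longrightarrow> cyclic_sum \<phi> \<psi> p q = 0\<close>)
      then show ?thesis unfolding pure_def by blast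
    qed
    \<comment> \<open>Cyclicity of \<open>\<psi>\<close> makes the three right factors equal;
      collecting them leaves the Lie defect of \<open>\<phi>\<close> on the left.
      \<open>cycl_lie\<close> is the mirror image.\<close>
    have lie_cycl: "cyclic_sum \<phi> \<psi> p q = 0"
      if "\<phi> \<in> HomLie sA mA" "\<psi> \<in> HomCycl sB mB" for \<phi> \<psi> p q
    proof -
      obtain a b c a' b' c' where pq: "p = (a, b, c)" "q = (a', b', c')" by (metis prod_cases3)
      have "mB (mB c' a') (\<psi> b') = mB (mB a' b') (\<psi> c')" "mB (mB b' c') (\<psi> a') = mB (mB a' b') (\<psi> c')"
        using that(2) unfolding HomCycl_def by (metis (mono_tags, lifting) mem_Collect_eq)+
      then have "cyclic_sum \<phi> \<psi> p q = tns (lie_defect mA \<phi> p) (mB (mB a' b') (\<psi> c'))"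
        by (simp add: pq cyclic_sum_def lie_defect_def tns_simps)
      then show ?thesis
        using that(1) by (simp add: pq HomLie_iff tns0)
    qed
    have cycl_lie: "cyclic_sum \<phi> \<psi> p q = 0"
      if "\<phi> \<in> HomCycl sA mA" "\<psi> \<in> HomLie sB mB" for \<phi> \<psi> p q
    proof -
      obtain a b c a' b' c' where pq: "p = (a, b, c)" "q = (a', b', c')" by (metis prod_cases3)
      have "mA (mA c a) (\<phi> b) = mA (mA a b) (\<phi> c)" "mA (mA b c) (\<phi> a) = mA (mA a b) (\<phi> c)"
        using that(1) unfolding HomCycl_def by (metis (mono_tags, lifting) mem_Collect_eq)+
      then have "cyclic_sum \<phi> \<psi> p q = tns (mA (mA a b) (\<phi> c)) (lie_defect mB \<psi> q)"
        by (simp add: pq cyclic_sum_def lie_defect_def tns_simps)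
      then show ?thesis
        using that(2) by (simp add: pq HomLie_iff tns0)
    qed
    have nilp: "cyclic_sum \<phi> \<psi> p q = 0"
      if "\<phi> \<in> Hom2Nilp sA mA \<or> \<psi> \<in> Hom2Nilp sB mB" for \<phi> \<psi> p q
      using that by (cases p; cases q) (auto simp: cyclic_sum_def Hom2Nilp_def tns0)
    have "?X \<subseteq> {e. \<Theta> e \<in> HomLie sT br}"
      by (intro Un_least pure_subset subsets order.refl) (blast intro: lie_cycl cycl_lie nilp)+
    then show "\<Theta> e \<in> HomLie sT br"
      using E.span_minimal[OF _ sub] e by blast
  next
    assume e: "\<Theta> e \<in> HomLie sT br"
    have lie_add: "lie_defect mA (\<phi> + \<chi>) p = lie_defect mA \<phi> p + lie_defect mA \<chi> p"
      and lie_scale: "lie_defect mA (fun_scale sA c \<phi>) p = sA c (lie_defect mA \<phi> p)"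
      and cycl_add: "cycl_defect mA (\<phi> + \<chi>) p = cycl_defect mA \<phi> p + cycl_defect mA \<chi> p"
      and cycl_scale: "cycl_defect mA (fun_scale sA c \<phi>) p = sA c (cycl_defect mA \<phi> p)" for \<phi> \<chi> p c
      by (auto simp: lie_defect_def cycl_defect_def fun_scale_def mA_simps A.scale_right_distrib
          A.scale_right_diff_distrib split: prod.splits)
    have sub: "FA.subspace (HomLie sA mA)" "FA.subspace (HomCycl sA mA)"
      unfolding HomLie_eq HomCycl_eq
      by (rule subspace_defect_kernel[OF A.vector_space_axioms lie_add lie_scale])
         (rule subspace_defect_kernel[OF A.vector_space_axioms cycl_add cycl_scale])
    \<comment> \<open>The block of a basis element dictates what its coefficient in
      \<open>End(B)\<close> must satisfy: nothing for \<open>B\<^sub>0\<close>, cyclicity for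
      \<open>B\<^sub>1\<close>, the Hom-Lie identity for \<open>B\<^sub>2\<close>, both for
      \<open>B\<^sub>3\<close>.\<close>
    obtain B\<^sub>0 B\<^sub>1 B\<^sub>2 B\<^sub>3 where ind: "FA.independent (B\<^sub>0 \<union> B\<^sub>1 \<union> B\<^sub>2 \<union> B\<^sub>3)"
      and sp: "FA.span (B\<^sub>0 \<union> B\<^sub>1 \<union> B\<^sub>2 \<union> B\<^sub>3) = End sA"
      and B: "B\<^sub>0 \<subseteq> HomLie sA mA \<inter> HomCycl sA mA" "B\<^sub>1 \<subseteq> HomLie sA mA" "B\<^sub>2 \<subseteq> HomCycl sA mA"
      and disj: "HomLie sA mA \<inter> FA.span (B\<^sub>2 \<union> B\<^sub>3) = {0}" "HomCycl sA mA \<inter> FA.span (B\<^sub>1 \<union> B\<^sub>3) = {0}"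
      by (rule FA.adapted_basis[OF sub subspace_End[OF A.vector_space_axioms] subsets(1,2)])
    obtain J f where J: "finite J" "J \<subseteq> B\<^sub>0 \<union> B\<^sub>1 \<union> B\<^sub>2 \<union> B\<^sub>3" "\<And>i. f i \<in> End sB" "e = (\<Sum>i\<in>J. tnsE i (f i))"
      using tensor_basis_expansion[OF E sp] by blast
    have End: "B\<^sub>0 \<union> B\<^sub>1 \<union> B\<^sub>2 \<union> B\<^sub>3 \<subseteq> End sA"
      unfolding sp[symmetric] by (rule FA.span_superset)
    then have "\<Theta> e (tns a b) = (\<Sum>i\<in>J. tns (i a) (f i b))" for a b
      unfolding J(4) \<Theta>.sum sum_fun_apply using J(2,3) by (intro sum.cong) (auto intro!: Theta_tnsE)
    then have cyc: "(\<Sum>i\<in>J. cyclic_sum i (f i) p q) = 0" for p q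
      using HomLie_tensor_iff[OF Theta_End, where J = J and \<phi> = "\<lambda>i. i" and \<psi> = f] e by blast
    have End': "FA.span (B\<^sub>2 \<union> B\<^sub>3) \<subseteq> End sA" "FA.span (B\<^sub>1 \<union> B\<^sub>3) \<subseteq> End sA"
      unfolding sp[symmetric] by (auto intro!: FA.span_mono)
    \<comment> \<open>For each fixed \<open>q\<close>, the coefficient defects are the right
      factors. Basis elements in \<open>B\<^sub>0 \<union> B\<^sub>1\<close> have no Lie defect, and
      the sum to be killed consists of three instances of \<open>cyc\<close>, one per
      rotation.\<close>
    have lie: "f i \<in> HomLie sB mB" if i: "i \<in> J" "i \<in> B\<^sub>2 \<union> B\<^sub>3" for i
    proof -
      have "lie_defect mB (f i) q = 0" for q
      proof (rule tensor_defect_eq_0D[of "lie_defect mA", OF lie_add lie_scale J(1) _ i])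
        show "FA.independent (B\<^sub>2 \<union> B\<^sub>3)"
          by (rule FA.independent_mono[OF ind]) blast
        show "lie_defect mA j p = 0" if "j \<in> J" "j \<notin> B\<^sub>2 \<union> B\<^sub>3" for j p
          using that J(2) B(1,2) HomLie_iff[of j sA mA] by blast
        show "\<phi> = 0" if "\<phi> \<in> FA.span (B\<^sub>2 \<union> B\<^sub>3)" "\<And>p. lie_defect mA \<phi> p = 0" for \<phi>
          using that disj(1) End'(1) HomLie_iff[of \<phi> sA mA] by blast
        show "(\<Sum>j\<in>J. tns (lie_defect mA j p) (lie_defect mB (f j) q)) = 0" for p
          by (cases p) (simp add: lie_defect_tensor sum.distrib cyc)
      qed
      then show ?thesis using J(3) by (simp add: HomLie_iff)
    qed
    \<comment> \<open>The same with the cyclic defect, which vanishes on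
      \<open>B\<^sub>0 \<union> B\<^sub>2\<close>; now the sum is a difference of two instances of
      \<open>cyc\<close>.\<close>
    have cycl: "f i \<in> HomCycl sB mB" if i: "i \<in> J" "i \<in> B\<^sub>1 \<union> B\<^sub>3" for i
    proof -
      have "cycl_defect mB (f i) q = 0" for q
      proof (rule tensor_defect_eq_0D[of "cycl_defect mA", OF cycl_add cycl_scale J(1) _ i])
        show "FA.independent (B\<^sub>1 \<union> B\<^sub>3)"
          by (rule FA.independent_mono[OF ind]) blast
        show "cycl_defect mA j p = 0" if "j \<in> J" "j \<notin> B\<^sub>1 \<union> B\<^sub>3" for j p
          using that J(2) B(1,3) HomCycl_iff[of j sA mA] by blast
        show "\<phi> = 0" if "\<phi> \<in> FA.span (B\<^sub>1 \<union> B\<^sub>3)" "\<And>p. cycl_defect mA \<phi> p = 0" for \<phi>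
          using that disj(2) End'(2) HomCycl_iff[of \<phi> sA mA] by blast
        show "(\<Sum>j\<in>J. tns (cycl_defect mA j p) (cycl_defect mB (f j) q)) = 0" for p
          by (cases p) (simp add: cycl_defect_tensor sum_subtractf cyc)
      qed
      then show ?thesis using J(3) by (simp add: HomCycl_iff)
    qed
    \<comment> \<open>Each block lands in one of the four summands; for \<open>B\<^sub>0\<close> and
      \<open>B\<^sub>3\<close>, \<open>three\<close> turns membership in both spaces into membership
      in \<open>Hom2Nilp\<close>.\<close>
    have "tnsE i (f i) \<in> ?X" if i: "i \<in> J" for i
    proof -
      have "i \<in> End sA" using i J(2) End by blast
      consider "i \<in> B\<^sub>0" | "i \<in> B\<^sub>1" | "i \<in> B\<^sub>2" | "i \<in> B\<^sub>3" using i J(2) by blast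
      then show ?thesis
      proof cases
        case 1
        then have "i \<in> Hom2Nilp sA mA"
          using B(1) HomLie_Int_HomCycl[OF A.vector_space_axioms three] by blast
        then show ?thesis using J(3) unfolding pure_def by blast
      next
        case 2
        then show ?thesis using cycl[OF i] B(2) unfolding pure_def by blast
      next
        case 3
        then show ?thesis using lie[OF i] B(3) unfolding pure_def by blast
      next
        case 4
        then have "f i \<in> Hom2Nilp sB mB"
          using lie[OF i] cycl[OF i] HomLie_Int_HomCycl[OF B.vector_space_axioms three] by blast
        then show ?thesis using \<open>i \<in> End sA\<close> unfolding pure_def by blast
      qed
    qed
    then show "e \<in> E.span ?X"
      unfolding J(4) by (intro E.span_sum E.span_base)
  qed
  then show ?thesis
    by (simp add: subspace_tensor_def plus pure_def)
qed

end

section \<open>The characteristic, the sign of the Koszul dual, and the conclusion\<close>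

lemma two_three_neq_0:
  assumes "CHAR('k::field) \<noteq> 2" "CHAR('k) \<noteq> 3"
  shows "(2::'k) \<noteq> 0" "(3::'k) \<noteq> 0"
proof -
  have one: "\<not> CHAR('k) dvd 1"
    using of_nat_eq_0_iff_char_dvd[where 'a = 'k, of 1] by simp
  have "\<not> CHAR('k) dvd 2"
  proof
    assume dvd: "CHAR('k) dvd 2"
    then have "CHAR('k) \<le> 2" by (rule dvd_imp_le) simp
    then have "CHAR('k) = 0 \<or> CHAR('k) = 1 \<or> CHAR('k) = 2" by linarith
    then show False using dvd one assms by auto
  qed
  then show "(2::'k) \<noteq> 0"
    using of_nat_eq_0_iff_char_dvd[where 'a = 'k, of 2] by simp
  have "\<not> CHAR('k) dvd 3"
  proof
    assume dvd: "CHAR('k) dvd 3"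
    then have "CHAR('k) \<le> 3" by (rule dvd_imp_le) simp
    then have "CHAR('k) = 0 \<or> CHAR('k) = 1 \<or> CHAR('k) = 2 \<or> CHAR('k) = 3" by linarith
    then show False using dvd one assms by auto
  qed
  then show "(3::'k) \<noteq> 0"
    using of_nat_eq_0_iff_char_dvd[where 'a = 'k, of 3] by simp
qed

theorem theorem2:
  fixes P :: "('k::field, 'p::ab_group_add) operad_data" and \<mu> :: 'p
    and Q :: "('k, 'q::ab_group_add) operad_data" and \<nu> :: 'q
    and sA :: "'k \<Rightarrow> 'a::ab_group_add \<Rightarrow> 'a" and \<alpha> :: "nat set \<Rightarrow> 'p \<Rightarrow> (nat \<Rightarrow> 'a) \<Rightarrow> 'a"
    and sB :: "'k \<Rightarrow> 'b::ab_group_add \<Rightarrow> 'b" and \<beta> :: "nat set \<Rightarrow> 'q \<Rightarrow> (nat \<Rightarrow> 'b) \<Rightarrow> 'b"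
    and sT :: "'k \<Rightarrow> 't::ab_group_add \<Rightarrow> 't" and tns :: "'a \<Rightarrow> 'b \<Rightarrow> 't"
    and sE :: "'k \<Rightarrow> 'e::ab_group_add \<Rightarrow> 'e" and tnsE :: "('a \<Rightarrow> 'a) \<Rightarrow> ('b \<Rightarrow> 'b) \<Rightarrow> 'e"
    and mA :: "'a \<Rightarrow> 'a \<Rightarrow> 'a" and mB :: "'b \<Rightarrow> 'b \<Rightarrow> 'b"
  assumes char: "CHAR('k) \<noteq> 2" "CHAR('k) \<noteq> 3"
    and P: "commutative_quadratic_operad P \<mu>"
    and Q: "koszul_dual_operad P \<mu> Q \<nu>"
    and A: "operad_algebra P sA \<alpha>" and mA: "mA = algebra_product \<alpha> \<mu>"
    and B: "operad_algebra Q sB \<beta>" and mB: "mB = algebra_product \<beta> \<nu>"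
    and fin: "finite_dim sA \<or> finite_dim sB"
    and T: "is_tensor_product sA UNIV sB UNIV sT tns"
    and E: "is_tensor_product (fun_scale sA) (End sA) (fun_scale sB) (End sB) sE tnsE"
  shows "\<exists>\<Theta>. is_End_identification sA sB sT tns sE tnsE \<Theta> \<and>
    bij_betw \<Theta>
      (subspace_tensor sE tnsE (HomLie sA mA) (HomCycl sB mB)
        + subspace_tensor sE tnsE (Hom2Nilp sA mA) (End sB)
        + subspace_tensor sE tnsE (HomCycl sA mA) (HomLie sB mB)
        + subspace_tensor sE tnsE (End sA) (Hom2Nilp sB mB))
      (HomLie sT (tensor_bracket sT tns mA mB))"
proof -
  note two_three = two_three_neq_0[OF char]
  obtain R where "quadratic_operad P \<mu> 1 R"
    using P unfolding commutative_quadratic_operad_def by blast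
  note A_props = quadratic_operad_algebra[OF this A, folded mA]
  \<comment> \<open>A second presentation of \<open>P\<close>, for the same product
    \<open>mA\<close>: commutativity gave the sign \<open>1\<close>, Koszul duality gives some sign
    \<open>\<epsilon>\<close> and, for \<open>mB\<close>, the sign
    \<open>-\<epsilon>\<close>.\<close>
  obtain \<epsilon> R' where koszul: "quadratic_operad P \<mu> \<epsilon> R'" "quadratic_operad Q \<nu> (-\<epsilon>) (orthogonal_relations R')"
    using Q unfolding koszul_dual_operad_def by blast
  note A_sign = quadratic_operad_algebra(3)[OF koszul(1) A, folded mA]
    and B_props = quadratic_operad_algebra[OF koszul(2) B, folded mB]
  have vs: "vector_space sA" "vector_space sB" "vector_space sT"
    using T by (auto simp: is_tensor_product_def)
  interpret A: vector_space sA by (rule vs)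
  interpret B: vector_space sB by (rule vs)
  interpret T: vector_space sT by (rule vs)
  note bil = tns_bilinear_on[OF T, simplified]
  have commute: "mA a b = mA b a" for a b
    using A_props(3)[of a b] by simp
  have "\<exists>!br. is_tensor_bracket sT tns mA mB br"
    by (rule tensor_bracket_ex1[OF T A_props(1,2) B_props(1,2)])
  then have br: "is_tensor_bracket sT tns mA mB (tensor_bracket sT tns mA mB)"
    unfolding tensor_bracket_def by (rule theI')
  have double: "x + x = sV 2 x" if "vector_space sV" for sV :: "'k \<Rightarrow> 'v::ab_group_add \<Rightarrow> 'v" and x
  proof -
    interpret vector_space sV by fact
    show ?thesis using scale_left_distrib[of 1 1 x] by simp
  qed
  have "tns (mA a a') (mB b b') - tns (mA a' a) (mB b' b) = sT 2 (tns (mA a a') (mB b b'))" for a b a' b'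
  proof (cases "\<epsilon> = 1")
    case True
    then have "mB b' b = sB (-1) (mB b b')"
      using B_props(3)[of b' b] by simp
    then have "tns (mA a' a) (mB b' b) = - tns (mA a a') (mB b b')"
      by (simp add: bil commute[of a' a] del: B.scale_minus_left)
    then show ?thesis
      by (simp add: double[OF vs(3)])
  next
    \<comment> \<open>The definition of the Koszul dual does not fix the sign \<open>\<epsilon>\<close>; the wrong sign makes the product of
      \<open>A\<close> commutative and anticommutative, hence zero.\<close>
    case False
    then have "\<epsilon> = -1"
      using koszul(1) by (simp add: quadratic_operad_def)
    then have "mA a a' = - mA a a'" for a a'
      using A_sign[of a a'] commute[of a a'] by simp
    then have "sA 2 (mA a a') = 0" for a a'
      unfolding double[OF vs(1), symmetric] by (metis add.right_inverse)
    then have "mA a a' = 0" for a a'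
      using two_three by simp
    moreover have "tns 0 b = 0" for b
      using bil(3)[of 0 0 b] by simp
    ultimately show ?thesis by simp
  qed
  then have br_tns: "tensor_bracket sT tns mA mB (tns a b) (tns a' b') = sT 2 (tns (mA a a') (mB b b'))" for a b a' b'
    using br by (simp add: is_tensor_bracket_def)
  have br_linear: "Vector_Spaces.linear sT sT (tensor_bracket sT tns mA mB x)"
    "Vector_Spaces.linear sT sT (\<lambda>x. tensor_bracket sT tns mA mB x y)" for x y
    using br by (simp_all add: is_tensor_bracket_def)
  obtain \<Theta> where \<Theta>: "is_End_identification sA sB sT tns sE tnsE \<Theta>"
    using End_identification_ex[OF T E fin] by blast
  have "doubled_tensor_bracket sA sB sT tns sE tnsE mA mB (tensor_bracket sT tns mA mB) \<Theta>"
  proof (rule doubled_tensor_bracket.intro)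
    show "Vector_Spaces.linear sA sA (mA x)" "Vector_Spaces.linear sA sA (\<lambda>x. mA x y)" for x y
      by (rule A_props(1)) (rule A_props(2))
    show "Vector_Spaces.linear sB sB (mB x)" "Vector_Spaces.linear sB sB (\<lambda>x. mB x y)" for x y
      by (rule B_props(1)) (rule B_props(2))
    show "Vector_Spaces.linear sT sT (tensor_bracket sT tns mA mB x)"
      "Vector_Spaces.linear sT sT (\<lambda>x. tensor_bracket sT tns mA mB x y)" for x y
      by (rule br_linear(1)) (rule br_linear(2))
    show "mA a b = mA b a" for a b
      by (rule commute)
    show "tensor_bracket sT tns mA mB (tns a b) (tns a' b') = sT 2 (tns (mA a a') (mB b b'))" for a b a' b'
      by (rule br_tns)
  qed (fact two_three T E \<Theta>)+
  note HomLie_tensor = doubled_tensor_bracket.HomLie_tensor[OF this]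
  have bij: "bij_betw \<Theta> UNIV (End sT)"
    using \<Theta> by (simp add: is_End_identification_def)
  let ?H = "HomLie sT (tensor_bracket sT tns mA mB)"
  \<comment> \<open>Since \<open>?H\<close> lies in the image of the bijection
    \<open>\<Theta>\<close>, restricting \<open>\<Theta>\<close> to the preimage of
    \<open>?H\<close> gives a bijection onto \<open>?H\<close>; \<open>HomLie_tensor\<close>
    rewrites this preimage as the sum of the four subspaces.\<close>
  have "?H \<subseteq> End sT"
    by (auto simp: HomLie_def)
  then have "bij_betw \<Theta> {e. \<Theta> e \<in> ?H} ?H"
    using bij by (fastforce simp: bij_betw_def inj_on_def)
  then show ?thesis
    using \<Theta> unfolding HomLie_tensor Collect_mem_eq by blast
qed

end
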